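(* Let $m\ge3$, let $U\subset\mathbb{R}^m$ be a (connected, open) domain, $\vec F=(F_1,\dots,F_m)$ a $C^1$ vector field on $U$, and $u,v$ real-valued $C^2$ functions on $U$ such that $\nabla u+\vec F\neq0$ and $\nabla v+\vec F\ne0$ everywhere in $U$. Suppose $H_{\vec F}(u)\le H_{\vec F}(v)$ and $u\ge v$ in $U$, and $u=v$ at a point $p_0\in U$. Assume that the $m\times m$ matrix $(\partial_kF_j-\partial_jF_k)$ satisfies $$\operatorname{rank}(\partial_kF_j-\partial_jF_k)\ge3$$ in $U$. Then $u\equiv v$ in $U$.
   Context: $N_{\vec F}(u):=\frac{\nabla u+\vec F}{|\nabla u+\vec F|}$ and $H_{\vec F}(u):=\operatorname{div}N_{\vec F}(u)$ at points where $\nabla u+\vec F\ne0$ (Euclidean gradient, norm and divergence on $\mathbb{R}^m$); similarly for $v$. *)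

theory Defs
  imports "HOL-Analysis.Analysis"
begin

definition gradient :: "(real^'m \<Rightarrow> real) \<Rightarrow> real^'m \<Rightarrow> real^'m::finite"
  where "gradient u x = (\<chi> i. frechet_derivative u (at x) (axis i 1))"

(* The entry jacobian f (at x) $ i $ k is the partial derivative of f_i in direction k. *)

definition divergence :: "(real^'m \<Rightarrow> real^'m) \<Rightarrow> real^'m \<Rightarrow> real"
  where "divergence V x = (\<Sum>i\<in>UNIV. jacobian V (at x) $ i $ i)"

definition C1_on :: "(real^'m) set \<Rightarrow> (real^'m \<Rightarrow> real^'n) \<Rightarrow> bool"
  where "C1_on U f \<longleftrightarrow>
    (\<forall>x\<in>U. f differentiable (at x)) \<and> continuous_on U (\<lambda>x. jacobian f (at x))"

definition C2_on :: "(real^'m) set \<Rightarrow> (real^'m \<Rightarrow> real) \<Rightarrow> bool"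
  where "C2_on U u \<longleftrightarrow> (\<forall>x\<in>U. u differentiable (at x)) \<and> C1_on U (gradient u)"

definition N_field :: "(real^'m \<Rightarrow> real^'m) \<Rightarrow> (real^'m \<Rightarrow> real) \<Rightarrow> real^'m \<Rightarrow> real^'m"
  where "N_field F u x = (gradient u x + F x) /\<^sub>R norm (gradient u x + F x)"

definition H_op :: "(real^'m \<Rightarrow> real^'m) \<Rightarrow> (real^'m \<Rightarrow> real) \<Rightarrow> real^'m \<Rightarrow> real"
  where "H_op F u = divergence (N_field F u)"

(* Entry (j, k) is the k-th partial of F_j minus the j-th partial of F_k. *)
definition curl_matrix :: "(real^'m \<Rightarrow> real^'m) \<Rightarrow> real^'m \<Rightarrow> real^'m^'m"
  where "curl_matrix F x =
    (\<chi> j k. jacobian F (at x) $ j $ k - jacobian F (at x) $ k $ j)"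

end

(* The difference w = u - v \<ge> 0 satisfies a linear inequality A : D^2 w \<le> C |grad w| locally, where A is the
   orthogonal projection onto the complement of V = grad u + F, divided by |V|.  Hopf's barrier shows that
   every exterior normal of the contact set Z = {w = 0} is parallel to V; hence Z is nearly invariant along
   curves that are nearly tangent to the hyperplanes orthogonal to V (Bony).  Suppose Z has an exterior ball
   at z, with unit normal n.  If the curl of V does not vanish as a bilinear form on the complement of n,
   then the lift of a small circle of radius t to a nearly tangent curve starting at z ends at distance
   ~ t^2 from z in the direction n, and within o(t^2) of Z.  But the exterior ball only allows points of Z
   whose n-component is quadratically small.  Since curl V = curl F (the Hessian is symmetric) has rank at
   least 3, it cannot vanish on a hyperplane; so Z has no exterior ball, that is, Z is open. *)
theory Submission
  imports Defs
begin

subsection \<open>Second derivatives\<close>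

text \<open>The operator ignores second derivatives in the direction V, so Hopf's argument cannot
  exclude normals parallel to V; these are the ones left to the rank condition. The gain from the
  curl has order t^2, and freezing V at z would lose just as much: across a curve of size t, run
  with speed O(t), the slope of the hyperplanes changes by O(t). Hence the height of the curve
  follows the linear part of V at z, and only an error o(t^2) is left. For this the expansion of V
  at the one point z is enough. V is only C^1 and nothing is known about the regularity of Z, so the
  argument works without flows and without tangent spaces of Z: the curve is explicit, and its
  squared distance to Z is compared with an exponential, one nearest point at a time. A nearest
  point always has an exterior ball, the one about the point of the curve, so the statement on
  normals applies there. An exterior ball bounds Z on one side only. A circle run in one direction
  therefore gives one inequality for the curl form; exchanging \<open>a\<close> and \<open>b\<close>
  reverses it and gives the other.\<close>

lemma second_derivative_at_minimum:
  fixes g :: "'a::euclidean_space \<Rightarrow> real"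
  assumes "open S" "x0 \<in> S"
    and g: "\<And>x. x \<in> S \<Longrightarrow> (g has_derivative (\<lambda>d. G x \<bullet> d)) (at x)"
    and G: "(G has_derivative G') (at x0)"
    and min: "\<And>x. x \<in> S \<Longrightarrow> g x0 \<le> g x"
  shows "G x0 = 0" and "0 \<le> d \<bullet> G' d"
proof -
  have "(\<lambda>d. G x0 \<bullet> d) = (\<lambda>d. 0)"
    using differential_zero_maxmin[OF assms(2,1) g[OF assms(2)]] min by blast
  then show G0: "G x0 = 0"
    by (metis inner_eq_zero_iff)
  show "0 \<le> d \<bullet> G' d"
  proof (rule ccontr)
    assume "\<not> 0 \<le> d \<bullet> G' d"
    then have neg: "d \<bullet> G' d < 0" by simp
    have lin: "linear G'" using G has_derivative_linear by blast
    have line: "((\<lambda>s. x0 + s *\<^sub>R d) has_derivative (\<lambda>h. h *\<^sub>R d)) (at s)" for s :: real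
      by (auto intro!: derivative_eq_intros)
    have "((\<lambda>s. G (x0 + s *\<^sub>R d) \<bullet> d) has_derivative (\<lambda>h. G' (h *\<^sub>R d) \<bullet> d)) (at 0)"
      using has_derivative_compose[OF line[of 0], of G G'] G
      by (auto intro!: has_derivative_inner_left)
    then have "DERIV (\<lambda>s. G (x0 + s *\<^sub>R d) \<bullet> d) 0 :> d \<bullet> G' d"
      by (simp add: has_field_derivative_def linear_cmul[OF lin] inner_commute mult_commute_abs)
    from DERIV_neg_dec_right[OF this neg]
    obtain e where e: "e > 0" "\<And>h. 0 < h \<Longrightarrow> h < e \<Longrightarrow> G (x0 + h *\<^sub>R d) \<bullet> d < 0"
      using G0 by auto
    have "open ((\<lambda>s. x0 + s *\<^sub>R d) -` S)"
      by (intro open_vimage \<open>open S\<close> continuous_intros)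
    moreover have "0 \<in> (\<lambda>s. x0 + s *\<^sub>R d) -` S" using \<open>x0 \<in> S\<close> by simp
    ultimately obtain e' where e': "e' > 0" "ball 0 e' \<subseteq> (\<lambda>s. x0 + s *\<^sub>R d) -` S"
      using open_contains_ball by blast
    define h where "h = min e e' / 2"
    have h: "0 < h" "h < e" "h < e'" using e(1) e'(1) by (auto simp: h_def)
    have inS: "x0 + s *\<^sub>R d \<in> S" if "0 \<le> s" "s \<le> h" for s
      using that h e'(2) by (auto simp: subset_eq dist_norm)
    have der: "DERIV (\<lambda>s. g (x0 + s *\<^sub>R d)) s :> G (x0 + s *\<^sub>R d) \<bullet> d" if "0 \<le> s" "s \<le> h" for s
      using has_derivative_compose[OF line g[OF inS[OF that]]]
      by (simp add: has_field_derivative_def mult_commute_abs)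
    have "g (x0 + h *\<^sub>R d) < g (x0 + 0 *\<^sub>R d)"
    proof (rule DERIV_neg_imp_decreasing_open[OF h(1)])
      show "\<exists>y. DERIV (\<lambda>s. g (x0 + s *\<^sub>R d)) s :> y \<and> y < 0" if "0 < s" "s < h" for s
        using der[of s] e(2)[of s] that h by auto
      show "continuous_on {0..h} (\<lambda>s. g (x0 + s *\<^sub>R d))"
        by (rule DERIV_atLeastAtMost_imp_continuous_on) (use der in auto)
    qed
    then show False using min[OF inS[of h]] h by simp
  qed
qed

text \<open>The mean value theorem in the direction \<open>a\<close>, applied to the increment of
  \<open>g\<close> in the direction \<open>b\<close>, leaves a difference of two gradients, which
  the expansion of \<open>G\<close> at \<open>x0\<close> evaluates up to o(t). The second difference
  itself is symmetric in \<open>a\<close> and \<open>b\<close>; this is what the lemma is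
  for.\<close>

lemma second_difference_limit:
  fixes g :: "'a::euclidean_space \<Rightarrow> real"
  assumes "open S" "x0 \<in> S"
    and g: "\<And>x. x \<in> S \<Longrightarrow> (g has_derivative (\<lambda>d. G x \<bullet> d)) (at x)"
    and G: "(G has_derivative G') (at x0)"
    and "e > 0"
  shows "\<exists>\<delta>>0. \<forall>t. 0 < t \<longrightarrow> t < \<delta> \<longrightarrow>
    \<bar>g (x0 + t *\<^sub>R a + t *\<^sub>R b) - g (x0 + t *\<^sub>R a) - g (x0 + t *\<^sub>R b) + g x0 - t\<^sup>2 * (a \<bullet> G' b)\<bar> \<le> e * t\<^sup>2"
proof -
  \<comment> \<open>Two expansion errors, each at distance at most t times (norm a + norm b + 1)
    from \<open>x0\<close>, are paired with \<open>a\<close>; the added units keep the constant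
    positive.\<close>
  define K where "K = 2 * (norm a + norm b + 1) * (norm a + 1)"
  have lin: "linear G'" using G has_derivative_linear by blast
  have K: "K > 0" by (auto simp: K_def intro!: mult_pos_pos add_nonneg_pos)
  with \<open>e > 0\<close> have "e / K > 0" by simp
  then obtain r where r: "r > 0" and rG: "\<And>y. norm (y - x0) < r \<Longrightarrow>
      norm (G y - G x0 - G' (y - x0)) \<le> e / K * norm (y - x0)"
    using G unfolding has_derivative_at_alt by meson
  obtain r' where r': "r' > 0" "ball x0 r' \<subseteq> S"
    using \<open>open S\<close> \<open>x0 \<in> S\<close> open_contains_ball by blast
  define n where "n = norm a + norm b + 1"
  have n: "n > 0" by (auto simp: n_def intro: add_nonneg_pos)
  define \<delta> where "\<delta> = min r r' / n"
  have "\<delta> > 0" using r r' n by (auto simp: \<delta>_def)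
  moreover have "\<bar>g (x0 + t *\<^sub>R a + t *\<^sub>R b) - g (x0 + t *\<^sub>R a) - g (x0 + t *\<^sub>R b) + g x0 - t\<^sup>2 * (a \<bullet> G' b)\<bar> \<le> e * t\<^sup>2"
    if t: "0 < t" "t < \<delta>" for t
  proof -
    have tn: "t * n < r" "t * n < r'"
      using t n by (auto simp: \<delta>_def field_simps)
    define p where "p = (\<lambda>c s. x0 + s *\<^sub>R a + c *\<^sub>R b)"
    have small: "norm (p c s - x0) \<le> t * n" if "0 \<le> s" "s \<le> t" "0 \<le> c" "c \<le> t" for s c
    proof -
      have "norm (p c s - x0) \<le> s * norm a + c * norm b"
        unfolding p_def using norm_triangle_ineq[of "s *\<^sub>R a" "c *\<^sub>R b"] that by simp
      also have "\<dots> \<le> t * norm a + t * norm b"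
        using that by (intro add_mono mult_right_mono) auto
      also have "\<dots> \<le> t * n" using t by (simp add: n_def algebra_simps)
      finally show ?thesis .
    qed
    have inS: "p c s \<in> S" if "0 \<le> s" "s \<le> t" "0 \<le> c" "c \<le> t" for s c
      using small[OF that] tn r'(2) by (force simp: dist_norm norm_minus_commute)
    have der: "DERIV (\<lambda>s. g (p c s)) s :> G (p c s) \<bullet> a" if "0 \<le> s" "s \<le> t" "0 \<le> c" "c \<le> t" for s c
    proof -
      have "((\<lambda>s. p c s) has_derivative (\<lambda>h. h *\<^sub>R a)) (at s)"
        unfolding p_def by (auto intro!: derivative_eq_intros)
      from has_derivative_compose[OF this g[OF inS[OF that]]] show ?thesis
        by (simp add: has_field_derivative_def mult_commute_abs)
    qed
    obtain s where s: "0 < s" "s < t"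
      and eq: "(g (p t t) - g (p 0 t)) - (g (p t 0) - g (p 0 0)) = (t - 0) * (G (p t s) \<bullet> a - G (p 0 s) \<bullet> a)"
      using MVT2[OF t(1), of "\<lambda>s. g (p t s) - g (p 0 s)" "\<lambda>s. G (p t s) \<bullet> a - G (p 0 s) \<bullet> a"]
        DERIV_diff[OF der der] t by auto
    have err: "norm (G (p c s) - G x0 - G' (p c s - x0)) \<le> e / K * (t * n)" if "0 \<le> c" "c \<le> t" for c
    proof -
      have "norm (p c s - x0) \<le> t * n" using small s that by auto
      then show ?thesis
        using rG[of "p c s"] tn(1) \<open>e / K > 0\<close>
        by (smt (verit, best) mult_left_mono)
    qed
    have "G' (p t s - x0) - G' (p 0 s - x0) = t *\<^sub>R G' b"
      by (simp add: p_def linear_diff[OF lin, symmetric] linear_cmul[OF lin, symmetric])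
    then have "G (p t s) - G (p 0 s) - t *\<^sub>R G' b
        = (G (p t s) - G x0 - G' (p t s - x0)) - (G (p 0 s) - G x0 - G' (p 0 s - x0))"
      by (simp add: algebra_simps)
    then have "norm (G (p t s) - G (p 0 s) - t *\<^sub>R G' b)
        \<le> norm (G (p t s) - G x0 - G' (p t s - x0)) + norm (G (p 0 s) - G x0 - G' (p 0 s - x0))"
      by (metis norm_triangle_ineq4)
    then have "norm (G (p t s) - G (p 0 s) - t *\<^sub>R G' b) \<le> 2 * (e / K * (t * n))"
      using add_mono[OF err[OF less_imp_le[OF t(1)] order_refl] err[OF order_refl less_imp_le[OF t(1)]]]
      by (simp only: mult_2)
    then have *: "\<bar>(G (p t s) - G (p 0 s) - t *\<^sub>R G' b) \<bullet> a\<bar> \<le> 2 * (e / K * (t * n)) * norm a"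
      by (meson Cauchy_Schwarz_ineq2 mult_right_mono norm_ge_zero order_trans)
    also have "\<dots> \<le> 2 * (e / K * (t * n)) * (norm a + 1)"
      using t n \<open>e > 0\<close> K by (intro mult_left_mono) auto
    also have "\<dots> = e * t * ((2 * n * (norm a + 1)) / K)" by simp
    also have "2 * n * (norm a + 1) = K" by (simp add: K_def n_def)
    also have "e * t * (K / K) = e * t" using K by simp
    finally have "t * \<bar>(G (p t s) - G (p 0 s) - t *\<^sub>R G' b) \<bullet> a\<bar> \<le> t * (e * t)"
      using t by (intro mult_left_mono) auto
    moreover have "g (x0 + t *\<^sub>R a + t *\<^sub>R b) - g (x0 + t *\<^sub>R a) - g (x0 + t *\<^sub>R b) + g x0 - t\<^sup>2 * (a \<bullet> G' b)
       = t * ((G (p t s) - G (p 0 s) - t *\<^sub>R G' b) \<bullet> a)"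
      using eq by (simp add: p_def algebra_simps inner_commute power2_eq_square)
    ultimately show ?thesis
      using t by (simp add: abs_mult power2_eq_square mult_ac)
  qed
  ultimately show ?thesis by blast
qed

text \<open>One second difference approximates both sides. With \<open>e\<close> a third of the
  supposed gap, two errors \<open>e\<close> cannot bridge it. Applied to the Hessian of
  \<open>u\<close>, this makes the curl of V that of F.\<close>

lemma symmetric_second_derivative:
  fixes g :: "'a::euclidean_space \<Rightarrow> real"
  assumes "open S" "x0 \<in> S"
    and g: "\<And>x. x \<in> S \<Longrightarrow> (g has_derivative (\<lambda>d. G x \<bullet> d)) (at x)"
    and G: "(G has_derivative G') (at x0)"
  shows "a \<bullet> G' b = b \<bullet> G' a"
proof (rule ccontr)
  assume ne: "a \<bullet> G' b \<noteq> b \<bullet> G' a"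
  define e where "e = \<bar>a \<bullet> G' b - b \<bullet> G' a\<bar> / 3"
  have e: "e > 0" using ne by (simp add: e_def)
  obtain \<delta>1 where \<delta>1: "\<delta>1 > 0" "\<And>t. 0 < t \<Longrightarrow> t < \<delta>1 \<Longrightarrow> 
    \<bar>g (x0 + t *\<^sub>R a + t *\<^sub>R b) - g (x0 + t *\<^sub>R a) - g (x0 + t *\<^sub>R b) + g x0 - t\<^sup>2 * (a \<bullet> G' b)\<bar> \<le> e * t\<^sup>2"
    using second_difference_limit[OF assms e] by metis
  obtain \<delta>2 where \<delta>2: "\<delta>2 > 0" "\<And>t. 0 < t \<Longrightarrow> t < \<delta>2 \<Longrightarrow> 
    \<bar>g (x0 + t *\<^sub>R b + t *\<^sub>R a) - g (x0 + t *\<^sub>R b) - g (x0 + t *\<^sub>R a) + g x0 - t\<^sup>2 * (b \<bullet> G' a)\<bar> \<le> e * t\<^sup>2"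
    using second_difference_limit[OF assms e] by metis
  define t where "t = min \<delta>1 \<delta>2 / 2"
  have t: "0 < t" "t < \<delta>1" "t < \<delta>2" using \<delta>1(1) \<delta>2(1) by (auto simp: t_def)
  have "\<bar>t\<^sup>2 * (a \<bullet> G' b) - t\<^sup>2 * (b \<bullet> G' a)\<bar> \<le> 2 * (e * t\<^sup>2)"
    using \<delta>1(2)[OF t(1,2)] \<delta>2(2)[OF t(1,3)] by (simp add: add.commute add.left_commute)
  then have "t\<^sup>2 * \<bar>a \<bullet> G' b - b \<bullet> G' a\<bar> \<le> t\<^sup>2 * (2 * e)"
    by (simp add: right_diff_distrib[symmetric] abs_mult mult.commute[of e])
  then have "\<bar>a \<bullet> G' b - b \<bullet> G' a\<bar> \<le> 2 * e"
    using t by (simp add: mult_le_cancel_left)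
  then show False using e by (simp add: e_def)
qed

subsection \<open>The degenerate elliptic operator and exterior balls\<close>

(* tangential_trace P M / norm P is the mean curvature operator with M the derivative of the field P. *)
definition tangential_trace :: "'a::euclidean_space \<Rightarrow> ('a \<Rightarrow> 'a) \<Rightarrow> real"
  where "tangential_trace P M = (\<Sum>b\<in>Basis. b \<bullet> M b) - (P \<bullet> M P) / (P \<bullet> P)"

lemma tangential_trace_diff:
  "tangential_trace P (\<lambda>d. M d - N d) = tangential_trace P M - tangential_trace P N"
  by (simp add: tangential_trace_def inner_diff_right sum_subtractf diff_divide_distrib)

lemma tangential_trace_scaleR:
  "tangential_trace P (\<lambda>d. c *\<^sub>R M d) = c * tangential_trace P M"
  by (simp add: tangential_trace_def sum_distrib_left right_diff_distrib)

text \<open>The quantity is the trace of \<open>M\<close> compressed to the complement of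
  \<open>P\<close>, so it is a sum of values of the quadratic form of \<open>M\<close> at projected
  basis vectors.\<close>

lemma tangential_trace_nonneg:
  fixes M :: "'a::euclidean_space \<Rightarrow> 'a"
  assumes lin: "linear M" and psd: "\<And>d. 0 \<le> d \<bullet> M d" and "P \<noteq> 0"
  shows "0 \<le> tangential_trace P M"
proof -
  define p where "p = P /\<^sub>R norm P"
  have p: "p \<bullet> p = 1"
    using \<open>P \<noteq> 0\<close> by (simp add: p_def dot_square_norm power2_eq_square)
  have pMp: "p \<bullet> M p = (P \<bullet> M P) / (P \<bullet> P)"
    by (simp add: p_def linear_cmul[OF lin] dot_square_norm power2_eq_square divide_inverse mult_ac)
  \<comment> \<open>On expansion, each of the two mixed sums equals \<open>p \<bullet> M p\<close>
    and the last term adds it back once; the trace minus \<open>p \<bullet> M p\<close>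
    remains.\<close>
  have "0 \<le> (\<Sum>b\<in>Basis. (b - (b \<bullet> p) *\<^sub>R p) \<bullet> M (b - (b \<bullet> p) *\<^sub>R p))"
    by (intro sum_nonneg psd)
  also have "\<dots> = (\<Sum>b\<in>Basis. b \<bullet> M b) - (\<Sum>b\<in>Basis. (b \<bullet> p) * (b \<bullet> M p))
      - (\<Sum>b\<in>Basis. (b \<bullet> p) * (p \<bullet> M b)) + (\<Sum>b\<in>Basis. (b \<bullet> p) * (b \<bullet> p)) * (p \<bullet> M p)"
    by (simp add: linear_diff[OF lin] linear_cmul[OF lin] inner_diff_left inner_diff_right
        sum_subtractf sum.distrib sum_distrib_left sum_distrib_right algebra_simps)
  also have "(\<Sum>b\<in>Basis. (b \<bullet> p) * (b \<bullet> M p)) = p \<bullet> M p"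
    by (subst (3) euclidean_inner) (simp add: inner_commute)
  also have "(\<Sum>b\<in>Basis. (b \<bullet> p) * (p \<bullet> M b)) = p \<bullet> M (\<Sum>b\<in>Basis. (p \<bullet> b) *\<^sub>R b)"
    by (simp add: linear_sum[OF lin] linear_cmul[OF lin] inner_sum_right inner_commute)
  also have "(\<Sum>b\<in>Basis. (p \<bullet> b) *\<^sub>R b) = p"
    by (rule euclidean_representation)
  also have "(\<Sum>b\<in>Basis. (b \<bullet> p) * (b \<bullet> p)) = 1"
    using p euclidean_inner[of p p] by (simp add: inner_commute)
  finally show ?thesis
    using pMp by (simp add: tangential_trace_def)
qed

text \<open>The operators of \<open>u\<close> and \<open>v\<close> have different coefficients. This
  is the price for moving the derivative of the field of \<open>v\<close> onto the coefficients of
  \<open>u\<close>: a multiple of |P - Q|, which is the gradient of the difference.\<close>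

lemma tangential_trace_Lipschitz:
  fixes M :: "'a::euclidean_space \<Rightarrow> 'a"
    and K :: real
  assumes lin: "linear M" and K: "\<And>d. norm (M d) \<le> K * norm d" and c: "c > 0" "c \<le> norm P" "c \<le> norm Q"
  shows "\<bar>tangential_trace P M / norm P - tangential_trace Q M / norm Q\<bar>
     \<le> (DIM('a) + 5) * K / c\<^sup>2 * norm (P - Q)"
proof -
  define p q where "p = P /\<^sub>R norm P" and "q = Q /\<^sub>R norm Q"
  have P0: "norm P > 0" "norm Q > 0" using c by auto
  have np: "norm p = 1" "norm q = 1" using P0 by (auto simp: p_def q_def)
  have K0: "K \<ge> 0"
    using K[of p] np norm_ge_zero[of "M p"] by (simp del: norm_ge_zero)
  have bil: "\<bar>x \<bullet> M y\<bar> \<le> K * norm x * norm y" for x y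
  proof -
    have "\<bar>x \<bullet> M y\<bar> \<le> norm x * norm (M y)" by (rule Cauchy_Schwarz_ineq2)
    also have "\<dots> \<le> norm x * (K * norm y)" by (intro mult_left_mono K) auto
    finally show ?thesis by (simp add: mult_ac)
  qed
  define T where "T = (\<Sum>b\<in>Basis. b \<bullet> M b)"
  have T: "\<bar>T\<bar> \<le> DIM('a) * K"
  proof -
    have "\<bar>T\<bar> \<le> (\<Sum>b\<in>Basis. \<bar>b \<bullet> M b\<bar>)" unfolding T_def by (rule sum_abs)
    also have "\<dots> \<le> (\<Sum>b\<in>(Basis::'a set). K)"
      using bil by (intro sum_mono) (metis mult.right_neutral norm_Basis)
    finally show ?thesis by simp
  qed
  have tr: "tangential_trace P M = T - p \<bullet> M p" "tangential_trace Q M = T - q \<bullet> M q"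
    by (simp_all add: T_def p_def q_def tangential_trace_def linear_cmul[OF lin] dot_square_norm
        power2_eq_square divide_inverse mult_ac)
  define e where "e = norm (P - Q)"
  have e: "\<bar>norm P - norm Q\<bar> \<le> e" "e \<ge> 0"
    unfolding e_def using norm_triangle_ineq3 by auto
  have inv: "\<bar>1 / norm P - 1 / norm Q\<bar> \<le> e / c\<^sup>2"
  proof -
    have "1 / norm P - 1 / norm Q = (norm Q - norm P) / (norm P * norm Q)"
      using P0 by (simp add: field_simps)
    then have "\<bar>1 / norm P - 1 / norm Q\<bar> = \<bar>norm P - norm Q\<bar> / (norm P * norm Q)"
      using P0 by (simp add: abs_mult abs_minus_commute)
    also have "\<dots> \<le> e / (c * c)"
      using e c P0 by (intro frac_le mult_mono) auto
    finally show ?thesis by (simp add: power2_eq_square)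
  qed
  have pq: "norm (p - q) \<le> 2 * e / c"
  proof -
    have "p - q = (P - Q) /\<^sub>R norm P + ((norm Q - norm P) / norm P) *\<^sub>R q"
      using P0 by (simp add: p_def q_def algebra_simps divide_inverse diff_divide_distrib)
    then have "norm (p - q) \<le> norm ((P - Q) /\<^sub>R norm P) + norm (((norm Q - norm P) / norm P) *\<^sub>R q)"
      using norm_triangle_ineq by metis
    also have "\<dots> = (e + \<bar>norm P - norm Q\<bar>) / norm P"
      using np P0 by (simp add: e_def abs_minus_commute[of "norm P"] abs_mult divide_inverse distrib_left mult.commute)
    also have "\<dots> \<le> (2 * e) / c"
      using e c by (intro frac_le) auto
    finally show ?thesis .
  qed
  \<comment> \<open>The change of the factor 1/norm accounts for DIM + 1 in the constant; the change
    of the unit vector, once in each slot of the form and with \<open>norm (p - q)\<close> at most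
    2e/c, accounts for 2 + 2.\<close>
  have "tangential_trace P M / norm P - tangential_trace Q M / norm Q
      = (T - p \<bullet> M p) * (1 / norm P - 1 / norm Q) - (p \<bullet> M (p - q) + (p - q) \<bullet> M q) / norm Q"
    by (simp add: tr linear_diff[OF lin] inner_diff_left inner_diff_right algebra_simps
        diff_divide_distrib add_divide_distrib)
  then have "\<bar>tangential_trace P M / norm P - tangential_trace Q M / norm Q\<bar>
      \<le> \<bar>T - p \<bullet> M p\<bar> * \<bar>1 / norm P - 1 / norm Q\<bar> + \<bar>p \<bullet> M (p - q) + (p - q) \<bullet> M q\<bar> / norm Q"
    using P0 abs_triangle_ineq4 by (metis abs_mult abs_divide abs_norm_cancel)
  also have "\<dots> \<le> (DIM('a) * K + K) * (e / c\<^sup>2) + (2 * K * (2 * e / c)) / c"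
  proof (intro add_mono mult_mono frac_le inv)
    show "\<bar>T - p \<bullet> M p\<bar> \<le> DIM('a) * K + K" using T bil[of p p] np by simp
    show "\<bar>p \<bullet> M (p - q) + (p - q) \<bullet> M q\<bar> \<le> 2 * K * (2 * e / c)"
    proof -
      have "\<bar>p \<bullet> M (p - q) + (p - q) \<bullet> M q\<bar> \<le> 2 * (K * norm (p - q))"
        using bil[of p "p - q"] bil[of "p - q" q] np by simp
      also have "\<dots> \<le> 2 * (K * (2 * e / c))"
        using pq K0 by (intro mult_left_mono) auto
      finally show ?thesis by simp
    qed
  qed (use c e K0 in auto)
  also have "\<dots> = (DIM('a) + 5) * K / c\<^sup>2 * norm (P - Q)"
    using c by (simp add: e_def power2_eq_square field_simps)
  finally show ?thesis .
qed

text \<open>The map has the shape of the Hessian of Hopf's barrier exp(-alpha |x - c|^2) with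
  \<open>\<xi>\<close> = x - c. Its large term survives exactly through the component of
  \<open>\<xi>\<close> orthogonal to \<open>P\<close>.\<close>

lemma tangential_trace_rank_one:
  fixes P \<xi> :: "'a::euclidean_space"
  assumes "P \<noteq> 0"
  shows "tangential_trace P (\<lambda>d. (k * (\<xi> \<bullet> d)) *\<^sub>R \<xi> - l *\<^sub>R d)
    = k * (\<xi> \<bullet> \<xi> - (P \<bullet> \<xi>)\<^sup>2 / (P \<bullet> P)) - l * (DIM('a) - 1)"
proof -
  have "tangential_trace P (\<lambda>d. (k * (\<xi> \<bullet> d)) *\<^sub>R \<xi> - l *\<^sub>R d)
      = k * tangential_trace P (\<lambda>d. (\<xi> \<bullet> d) *\<^sub>R \<xi>) - l * tangential_trace P (\<lambda>d. d)"
    using tangential_trace_diff[of P "\<lambda>d. k *\<^sub>R ((\<xi> \<bullet> d) *\<^sub>R \<xi>)" "\<lambda>d. l *\<^sub>R d"]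
    unfolding tangential_trace_scaleR by (simp only: scaleR_scaleR)
  moreover have "tangential_trace P (\<lambda>d. d) = DIM('a) - 1"
    using assms by (simp add: tangential_trace_def)
  moreover have "tangential_trace P (\<lambda>d. (\<xi> \<bullet> d) *\<^sub>R \<xi>) = \<xi> \<bullet> \<xi> - (P \<bullet> \<xi>)\<^sup>2 / (P \<bullet> P)"
    using euclidean_inner[of \<xi> \<xi>]
    by (simp add: tangential_trace_def inner_commute power2_eq_square)
  ultimately show ?thesis by simp
qed

text \<open>Hopf's boundary argument needs ellipticity only in the direction of the normal. If
  \<open>y - z\<close> is not parallel to \<open>P z\<close>, the operator does see that direction
  near \<open>z\<close>, and a steep enough barrier violates the differential inequality.\<close>

lemma exterior_ball_normal_parallel:
  fixes w :: "'a::euclidean_space \<Rightarrow> real" and P :: "'a \<Rightarrow> 'a"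
  assumes "open S" "z \<in> S"
    and w: "\<And>x. x \<in> S \<Longrightarrow> (w has_derivative (\<lambda>d. G x \<bullet> d)) (at x)"
    and G: "\<And>x. x \<in> S \<Longrightarrow> (G has_derivative G' x) (at x)"
    and P: "continuous_on S P" "\<And>x. x \<in> S \<Longrightarrow> P x \<noteq> 0"
    and ineq: "\<And>x. x \<in> S \<Longrightarrow> tangential_trace (P x) (G' x) \<le> C * norm (G x)"
    and nonneg: "\<And>x. x \<in> S \<Longrightarrow> 0 \<le> w x" and "w z = 0"
    and pos: "\<And>x. x \<in> S \<Longrightarrow> dist y x < dist y z \<Longrightarrow> 0 < w x"
  shows "collinear {0, y - z, P z}"
proof (rule ccontr)
  assume ncol: "\<not> collinear {0, y - z, P z}"
  then have "y \<noteq> z" by (auto simp: insert_commute)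
  (* The ball of half the radius about c meets the contact set only at z. *)
  define c where "c = z + (1/2) *\<^sub>R (y - z)"
  define r where "r = norm (z - c)"
  have r: "r > 0" using \<open>y \<noteq> z\<close> by (simp add: r_def c_def)
  \<comment> \<open>The squared length of the part of x - c orthogonal to \<open>P x\<close>, which
    takes over the role of the ellipticity constant: it multiplies 4 alpha^2 in the operator applied
    to the barrier.\<close>
  define \<kappa> where "\<kappa> x = (norm (x - c))\<^sup>2 - (P x \<bullet> (x - c))\<^sup>2 / (P x \<bullet> P x)" for x
  have "\<kappa> z > 0"
  proof -
    have zc: "z - c = (-1/2) *\<^sub>R (y - z)" by (simp add: c_def)
    have "\<bar>(y - z) \<bullet> P z\<bar> < norm (y - z) * norm (P z)"
      using ncol Cauchy_Schwarz_ineq2[of "y - z" "P z"]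
      by (simp add: norm_cauchy_schwarz_equal[symmetric])
    then have "\<bar>P z \<bullet> (z - c)\<bar> < norm (z - c) * norm (P z)"
      by (simp add: zc inner_commute)
    then have "(P z \<bullet> (z - c))\<^sup>2 < (norm (z - c) * norm (P z))\<^sup>2"
      by (metis abs_ge_zero power2_abs power_strict_mono zero_less_numeral)
    then show ?thesis
      using P(2)[OF \<open>z \<in> S\<close>] by (simp add: \<kappa>_def dot_square_norm power_mult_distrib field_simps)
  qed
  have cont\<kappa>: "continuous_on S \<kappa>"
    unfolding \<kappa>_def using P by (intro continuous_intros) auto
  then have "open (\<kappa> -` {\<kappa> z / 2<..} \<inter> S)"
    using continuous_on_open_vimage[OF \<open>open S\<close>] open_greaterThan by blast
  moreover have "z \<in> \<kappa> -` {\<kappa> z / 2<..} \<inter> S" using \<open>\<kappa> z > 0\<close> \<open>z \<in> S\<close> by auto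
  ultimately obtain \<delta> where \<delta>: "\<delta> > 0" "cball z \<delta> \<subseteq> \<kappa> -` {\<kappa> z / 2<..} \<inter> S"
    using open_contains_cball by blast
  then have inS: "\<And>x. x \<in> cball z \<delta> \<Longrightarrow> x \<in> S" and \<kappa>_big: "\<And>x. x \<in> cball z \<delta> \<Longrightarrow> \<kappa> z / 2 < \<kappa> x"
    by auto
  define R where "R = r + \<delta>"
  have R: "norm (x - c) \<le> R" if "x \<in> cball z \<delta>" for x
    using norm_triangle_ineq[of "x - z" "z - c"] that by (auto simp: R_def r_def dist_norm norm_minus_commute)
  \<comment> \<open>Chosen so that 2 alpha times \<open>\<kappa> z / 2\<close> is DIM + |C| R, while
    the inequality at the minimum allows at most DIM - 1 + |C| R.\<close>
  define \<alpha> where "\<alpha> = (DIM('a) + \<bar>C\<bar> * R) / \<kappa> z"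
  have R0: "R > 0" using r \<delta> by (simp add: R_def)
  have \<alpha>: "\<alpha> > 0" using \<open>\<kappa> z > 0\<close> R0 by (auto simp: \<alpha>_def intro!: divide_pos_pos add_pos_nonneg)
  define E where "E x = exp (- \<alpha> * ((x - c) \<bullet> (x - c)))" for x
  define h where "h x = E x - exp (- \<alpha> * r\<^sup>2)" for x
  define Gh where "Gh x = (- 2 * \<alpha> * E x) *\<^sub>R (x - c)" for x
  define Hh where "Hh x d = E x *\<^sub>R ((4 * \<alpha>\<^sup>2 * ((x - c) \<bullet> d)) *\<^sub>R (x - c) - (2 * \<alpha>) *\<^sub>R d)" for x d
  have E: "(E has_derivative (\<lambda>d. - 2 * \<alpha> * E x * ((x - c) \<bullet> d))) (at x)" for x
    unfolding E_def by (auto intro!: derivative_eq_intros simp: inner_commute algebra_simps)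
  have h: "(h has_derivative (\<lambda>d. Gh x \<bullet> d)) (at x)" for x
    unfolding h_def Gh_def by (auto intro!: derivative_eq_intros E)
  have Gh: "(Gh has_derivative Hh x) (at x)" for x
  proof -
    have "((\<lambda>x. - 2 * \<alpha> * E x) has_derivative (\<lambda>d. - 2 * \<alpha> * (- 2 * \<alpha> * E x * ((x - c) \<bullet> d)))) (at x)"
      by (rule has_derivative_mult_right[OF E])
    moreover have "((\<lambda>x. x - c) has_derivative (\<lambda>d. d)) (at x)"
      by (auto intro!: derivative_eq_intros)
    ultimately have "(Gh has_derivative (\<lambda>d. (- 2 * \<alpha> * E x) *\<^sub>R d
        + (- 2 * \<alpha> * (- 2 * \<alpha> * E x * ((x - c) \<bullet> d))) *\<^sub>R (x - c))) (at x)"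
      unfolding Gh_def by (rule has_derivative_scaleR)
    moreover have "(\<lambda>d. (- 2 * \<alpha> * E x) *\<^sub>R d
        + (- 2 * \<alpha> * (- 2 * \<alpha> * E x * ((x - c) \<bullet> d))) *\<^sub>R (x - c)) = Hh x"
      by (simp add: Hh_def fun_eq_iff scaleR_diff_right power2_eq_square mult_ac del: inner_diff_left)
    ultimately show ?thesis by simp
  qed
  have strict: "dist y x < dist y z" if "norm (x - c) \<le> r" "x \<noteq> z" for x
  proof -
    define a b where "a = x - z" and "b = c - z"
    have y: "y = z + 2 *\<^sub>R b" by (simp add: b_def c_def)
    have yx: "y - x = 2 *\<^sub>R b - a" and yz: "y - z = 2 *\<^sub>R b"
      by (simp_all only: y a_def) simp_all
    have "a - b = x - c" "b = - (z - c)" by (simp_all add: a_def b_def)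
    then have "norm (a - b) \<le> norm b" using that(1) by (simp only: r_def norm_minus_cancel)
    then have "(a - b) \<bullet> (a - b) \<le> b \<bullet> b" by (simp only: norm_le)
    then have "a \<bullet> a \<le> 2 * (a \<bullet> b)"
      by (simp add: inner_diff_left inner_diff_right inner_commute[of b a])
    moreover have "a \<bullet> a > 0" using that(2) by (simp add: a_def)
    ultimately have "a \<bullet> a < 4 * (a \<bullet> b)" by linarith
    then have "(2 *\<^sub>R b - a) \<bullet> (2 *\<^sub>R b - a) < (2 *\<^sub>R b) \<bullet> (2 *\<^sub>R b)"
      by (simp add: inner_diff_left inner_diff_right inner_commute[of b a])
    then have "norm (2 *\<^sub>R b - a) < norm (2 *\<^sub>R b)" by (simp only: norm_lt)
    then show ?thesis by (simp only: dist_norm yx yz)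
  qed
  have contw: "continuous_on S w"
    by (rule continuous_at_imp_continuous_on) (use has_derivative_continuous[OF w] in auto)
  \<comment> \<open>On the small sphere the barrier \<open>h\<close> is negative outside
    \<open>cball c r\<close>, and below 1 everywhere. So a lower bound \<open>\<epsilon>\<close> of
    \<open>w\<close> on the compact part \<open>T\<close>, which avoids \<open>z\<close>, makes w -
    eps h positive on the whole sphere, while it vanishes at \<open>z\<close>. For empty
    \<open>T\<close> any positive value serves.\<close>
  define T where "T = sphere z \<delta> \<inter> cball c r"
  have "compact T" by (auto simp: T_def intro: compact_Int_closed)
  have Tpos: "0 < w x" if "x \<in> T" for x
  proof -
    have x: "dist z x = \<delta>" "dist c x \<le> r" using that by (auto simp: T_def)
    then have "norm (x - c) \<le> r" "x \<noteq> z" using \<delta>(1) by (auto simp: dist_norm norm_minus_commute[of x])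
    with strict have "dist y x < dist y z" by blast
    moreover have "x \<in> S" using x(1) inS by simp
    ultimately show ?thesis using pos by blast
  qed
  obtain \<epsilon> where \<epsilon>: "\<epsilon> > 0" "\<And>x. x \<in> T \<Longrightarrow> \<epsilon> \<le> w x"
  proof (cases "T = {}")
    case True
    then show ?thesis using that[of 1] by auto
  next
    case False
    have "continuous_on T w"
      by (rule continuous_on_subset[OF contw]) (use inS in \<open>auto simp: T_def\<close>)
    from continuous_attains_inf[OF \<open>compact T\<close> False this]
    show ?thesis using Tpos that by blast
  qed
  define \<phi> where "\<phi> x = w x - \<epsilon> * h x" for x
  have "continuous_on (cball z \<delta>) \<phi>"
  proof -
    have "continuous_on (cball z \<delta>) w"
      by (rule continuous_on_subset[OF contw]) (use inS in auto)
    then show ?thesis unfolding \<phi>_def h_def E_def by (intro continuous_intros)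
  qed
  then obtain x where x: "x \<in> cball z \<delta>" and xmin: "\<And>x'. x' \<in> cball z \<delta> \<Longrightarrow> \<phi> x \<le> \<phi> x'"
    using continuous_attains_inf[of "cball z \<delta>" \<phi>] \<delta>(1) by auto
  have \<phi>z: "\<phi> z = 0"
    using \<open>w z = 0\<close> by (simp add: \<phi>_def h_def E_def r_def dot_square_norm)
  have "x \<in> ball z \<delta>"
  proof (rule ccontr)
    assume "x \<notin> ball z \<delta>"
    then have xs: "x \<in> sphere z \<delta>" using x by auto
    have "\<phi> x > 0"
    proof (cases "x \<in> cball c r")
      case True
      have "E x \<le> 1" using \<alpha> by (simp add: E_def)
      then have "h x < 1" by (simp add: h_def) (smt (verit) exp_gt_zero)
      then have "\<epsilon> * h x < \<epsilon>" using \<epsilon>(1) by simp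
      then show ?thesis using \<epsilon>(2)[of x] True xs by (simp add: \<phi>_def T_def)
    next
      case False
      then have "r\<^sup>2 < (x - c) \<bullet> (x - c)"
        using r by (simp add: dot_square_norm dist_norm norm_minus_commute power_strict_mono)
      then have "h x < 0" using \<alpha> by (simp add: h_def E_def)
      then have "\<epsilon> * h x < 0" using \<epsilon>(1) by (simp add: mult_pos_neg)
      then show ?thesis using nonneg[OF inS[OF x]] by (simp add: \<phi>_def)
    qed
    then show False using xmin[of z] \<phi>z \<delta>(1) by simp
  qed
  \<comment> \<open>At the interior minimum the gradient of \<open>w\<close> is
    \<open>\<epsilon>\<close> times that of the barrier, and the Hessian of \<open>w\<close>
    dominates \<open>\<epsilon>\<close> times that of the barrier. The inequality for
    \<open>w\<close> thus passes to the barrier, where the factor \<open>\<epsilon> * E x\<close>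
    cancels.\<close>
  note min = second_derivative_at_minimum[of "ball z \<delta>" x \<phi> "\<lambda>x. G x - \<epsilon> *\<^sub>R Gh x" "\<lambda>d. G' x d - \<epsilon> *\<^sub>R Hh x d"]
  have 1: "(\<phi> has_derivative (\<lambda>d. (G x - \<epsilon> *\<^sub>R Gh x) \<bullet> d)) (at x)" if "x \<in> ball z \<delta>" for x
    unfolding \<phi>_def using that inS[of x]
    by (auto intro!: derivative_eq_intros w h simp: inner_diff_left)
  have 2: "((\<lambda>x. G x - \<epsilon> *\<^sub>R Gh x) has_derivative (\<lambda>d. G' x d - \<epsilon> *\<^sub>R Hh x d)) (at x)"
    using x inS[of x] by (auto intro!: derivative_eq_intros G Gh)
  have Gx: "G x = \<epsilon> *\<^sub>R Gh x"
    using min(1)[OF open_ball \<open>x \<in> ball z \<delta>\<close> 1 2] xmin by auto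
  have psd: "0 \<le> d \<bullet> (G' x d - \<epsilon> *\<^sub>R Hh x d)" for d
    using min(2)[OF open_ball \<open>x \<in> ball z \<delta>\<close> 1 2] xmin by auto
  have lin: "linear (\<lambda>d. G' x d - \<epsilon> *\<^sub>R Hh x d)"
    using 2 has_derivative_linear by blast
  have P0: "P x \<noteq> 0" using P(2) inS x by blast
  have "tangential_trace (P x) (Hh x) = E x * (4 * \<alpha>\<^sup>2 * \<kappa> x - 2 * \<alpha> * (DIM('a) - 1))"
  proof -
    have "tangential_trace (P x) (Hh x) =
        E x * tangential_trace (P x) (\<lambda>d. (4 * \<alpha>\<^sup>2 * ((x - c) \<bullet> d)) *\<^sub>R (x - c) - (2 * \<alpha>) *\<^sub>R d)"
      unfolding Hh_def by (rule tangential_trace_scaleR)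
    then show ?thesis
      by (simp only: tangential_trace_rank_one[OF P0] \<kappa>_def dot_square_norm)
  qed
  moreover have "\<epsilon> * tangential_trace (P x) (Hh x) \<le> tangential_trace (P x) (G' x)"
    using tangential_trace_nonneg[OF lin psd P0]
    by (simp add: tangential_trace_diff tangential_trace_scaleR)
  moreover have "C * norm (G x) \<le> \<epsilon> * (E x * (2 * \<alpha> * (\<bar>C\<bar> * R)))"
  proof -
    have "norm (G x) = \<epsilon> * (E x * (2 * \<alpha> * norm (x - c)))"
      using \<epsilon>(1) \<alpha> by (simp add: Gx Gh_def abs_mult E_def)
    also have "\<dots> \<le> \<epsilon> * (E x * (2 * \<alpha> * R))"
      using \<epsilon>(1) \<alpha> R[OF x] by (simp add: E_def)
    finally have "\<bar>C\<bar> * norm (G x) \<le> \<bar>C\<bar> * (\<epsilon> * (E x * (2 * \<alpha> * R)))"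
      by (intro mult_left_mono) auto
    moreover have "C * norm (G x) \<le> \<bar>C\<bar> * norm (G x)" by (intro mult_right_mono) auto
    ultimately show ?thesis by (simp add: mult_ac)
  qed
  ultimately have "\<epsilon> * (E x * (4 * \<alpha>\<^sup>2 * \<kappa> x - 2 * \<alpha> * (DIM('a) - 1))) \<le> \<epsilon> * (E x * (2 * \<alpha> * (\<bar>C\<bar> * R)))"
    using ineq[OF inS[OF x]] by simp
  moreover have "E x > 0" by (simp add: E_def)
  ultimately have "4 * \<alpha>\<^sup>2 * \<kappa> x - 2 * \<alpha> * (DIM('a) - 1) \<le> 2 * \<alpha> * (\<bar>C\<bar> * R)"
    using \<epsilon>(1) by (simp only: mult_le_cancel_left_pos)
  then have "2 * \<alpha> * (2 * \<alpha> * \<kappa> x - (DIM('a) - 1)) \<le> 2 * \<alpha> * (\<bar>C\<bar> * R)"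
    by (simp add: power2_eq_square algebra_simps)
  then have "2 * \<alpha> * \<kappa> x - (DIM('a) - 1) \<le> \<bar>C\<bar> * R" using \<alpha> by simp
  moreover have "2 * \<alpha> * (\<kappa> z / 2) < 2 * \<alpha> * \<kappa> x"
    using \<alpha> \<kappa>_big[OF x] by simp
  moreover have "2 * \<alpha> * (\<kappa> z / 2) = DIM('a) + \<bar>C\<bar> * R"
    using \<open>\<kappa> z > 0\<close> by (simp add: \<alpha>_def)
  ultimately show False by simp
qed

subsection \<open>Curves nearly tangent to the hyperplane field\<close>

text \<open>A distance to a set need not be differentiable, so the derivative condition is put on a
  function \<open>q\<close> that touches \<open>f\<close> from above, in practice the squared
  distance to one nearest point. If \<open>f\<close> exceeds \<open>p\<close> at \<open>s\<close>,
  take the last earlier time \<open>t\<close> with \<open>f t \<le> p t\<close>. Continuity gives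
  equality there, and just after \<open>t\<close> the function \<open>q\<close>, and
  \<open>f\<close> below it, falls under \<open>p\<close>.\<close>

lemma first_crossing_comparison:
  fixes f p :: "real \<Rightarrow> real"
  assumes cont: "continuous_on {0..T} f" "continuous_on {0..T} p" and "f 0 \<le> p 0"
    and cross: "\<And>s. 0 \<le> s \<Longrightarrow> s < T \<Longrightarrow> f s = p s \<Longrightarrow>
      \<exists>q D. q s = f s \<and> (\<forall>s'. f s' \<le> q s') \<and> DERIV (\<lambda>s. q s - p s) s :> D \<and> D < 0"
    and s: "0 \<le> s" "s \<le> T"
  shows "f s \<le> p s"
proof (rule ccontr)
  assume gt: "\<not> f s \<le> p s"
  define A where "A = {x \<in> {0..s}. f x - p x \<le> 0}"
  have "continuous_on {0..s} (\<lambda>x. f x - p x)"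
    by (intro continuous_intros continuous_on_subset[OF cont(1)] continuous_on_subset[OF cont(2)]) (use s in auto)
  then have clo: "closed A"
    unfolding A_def by (intro continuous_closed_preimage_constant closed_Collect_le continuous_on_closed_Collect_le) auto
  have ne: "A \<noteq> {}" using \<open>f 0 \<le> p 0\<close> s by (auto simp: A_def)
  have bdd: "bdd_above A" by (auto simp: A_def bdd_above_def)
  define t where "t = Sup A"
  have tA: "t \<in> A" unfolding t_def using closed_contains_Sup[OF ne bdd clo] .
  then have t: "0 \<le> t" "t < s" "f t \<le> p t" using gt by (auto simp: A_def order.order_iff_strict)
  have above: "p x < f x" if "t < x" "x \<le> s" for x
  proof (rule ccontr)
    assume "\<not> p x < f x"
    then have "x \<in> A" using that t by (auto simp: A_def)
    then show False using cSup_upper[OF _ bdd] that by (force simp: t_def)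
  qed
  have "f t = p t"
  proof (rule antisym[OF t(3)])
    have "((\<lambda>x. f x - p x) \<longlongrightarrow> f t - p t) (at_right t)"
    proof -
      have "((\<lambda>x. f x - p x) \<longlongrightarrow> f t - p t) (at t within {0..T})"
        using cont t s by (auto simp: continuous_on_def intro!: tendsto_diff)
      then have "((\<lambda>x. f x - p x) \<longlongrightarrow> f t - p t) (at t within {t..s})"
        by (rule tendsto_within_subset) (use t s in auto)
      then show ?thesis using t by (simp add: at_within_Icc_at_right)
    qed
    moreover have "eventually (\<lambda>x. 0 \<le> f x - p x) (at_right t)"
      unfolding eventually_at_right[OF t(2)] using above t by (intro exI[of _ s]) (auto intro: less_imp_le)
    ultimately have "0 \<le> f t - p t"
      using tendsto_lowerbound trivial_limit_at_right_real by blast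
    then show "p t \<le> f t" by simp
  qed
  then obtain q D where q: "q t = f t" "\<And>s'. f s' \<le> q s'" and D: "DERIV (\<lambda>s. q s - p s) t :> D" "D < 0"
    using cross[of t] t s by auto
  from DERIV_neg_dec_right[OF D] obtain d where d: "d > 0" "\<And>h. 0 < h \<Longrightarrow> h < d \<Longrightarrow> q (t + h) - p (t + h) < 0"
    using q(1) \<open>f t = p t\<close> by auto
  define h where "h = min d (s - t) / 2"
  have "0 < h" "h \<le> d / 2" "h \<le> (s - t) / 2" using d(1) t by (auto simp: h_def)
  then have "0 < h" "h < d" "t + h \<le> s" using d(1) t by auto
  then show False using above[of "t + h"] d(2)[of h] q(2)[of "t + h"] by simp
qed

text \<open>Since the component of \<open>W x\<close> along \<open>n\<close> is 1, the hyperplane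
  orthogonal to \<open>W x\<close> is a graph over the complement of \<open>n\<close>, with slope
  \<open>- (c' \<bullet> W x)\<close> in a direction \<open>c'\<close>; tangent curves are lifts of
  curves in that complement. The lift of a closed circle climbs along \<open>n\<close> when the
  antisymmetric part of \<open>B\<close> is positive. A descent would not contradict
  \<open>exterior\<close>, hence the one-sided conclusion.\<close>

lemma exterior_ball_derivative_form_le:
  fixes Z :: "'a::euclidean_space set" and W :: "'a \<Rightarrow> 'a"
  assumes "closed Z" "z \<in> Z" "norm n = 1" "\<rho> > 0"
    and Wn: "\<And>x. dist z x < \<rho> \<Longrightarrow> n \<bullet> W x = 1" and Wz: "W z = n"
    and B: "(W has_derivative B) (at z)"
    and normal: "\<And>x y. x \<in> Z \<Longrightarrow> dist z x < \<rho> \<Longrightarrow> dist z y < \<rho> \<Longrightarrow>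
      (\<And>x'. x' \<in> Z \<Longrightarrow> dist y x \<le> dist y x') \<Longrightarrow> \<exists>k. y - x = k *\<^sub>R W x"
    and exterior: "\<And>x. x \<in> Z \<Longrightarrow> n \<bullet> (x - z) \<le> C * (norm (x - z))\<^sup>2"
    and an: "a \<bullet> n = 0" and bn: "b \<bullet> n = 0"
  shows "a \<bullet> B b \<le> b \<bullet> B a"
proof (rule ccontr)
  assume "\<not> a \<bullet> B b \<le> b \<bullet> B a"

  \<comment> \<open>Constants and the scale of the circle\<close>
  define \<omega> where "\<omega> = (a \<bullet> B b - b \<bullet> B a) / 2"
  have \<omega>: "\<omega> > 0" using \<open>\<not> a \<bullet> B b \<le> b \<bullet> B a\<close> by (simp add: \<omega>_def)
  have lin: "linear B" and bl: "bounded_linear B" using B has_derivative_linear has_derivative_bounded_linear by blast+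
  obtain M where M: "M > 0" "\<And>x. norm (B x) \<le> M * norm x"
    using bounded_linear.pos_bounded[OF bl] by (metis mult.commute)
  \<comment> \<open>\<open>N\<close> bounds |c'|/t, 2N bounds |c|/t, \<open>H\<close> bounds |h|/t^2
    and \<open>G\<close> bounds |gamma - z|/t. \<open>K1\<close> and \<open>K2\<close> collect the
    errors in the derivative of the squared distance, \<open>K\<close> is the growth rate.
    \<open>\<eta>\<close> makes the final distance bound, K2 eta t^2 exp(pi K), equal to omega t^2;
    the exponent is pi K, not 2 pi K, because a square root is taken.\<close>
  define N where "N = norm a + norm b + 1"
  have N: "N > 0" by (auto simp: N_def intro: add_nonneg_pos)
  define H where "H = 2 * M * N\<^sup>2 + 9 * \<omega>"
  have H: "H > 0" using M N \<omega> by (auto simp: H_def intro!: add_nonneg_pos)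
  define G where "G = 2 * N + H"
  have G: "G > 0" using N H by (simp add: G_def)
  define K1 where "K1 = N * M"
  define K2 where "K2 = 2 * N * G + N * M * H"
  have K12: "K1 > 0" "K2 > 0" using N M H G by (auto simp: K1_def K2_def intro!: add_pos_pos mult_pos_pos)
  define K where "K = 2 * K1 + 3"
  define K3 where "K3 = K2 * exp (pi * K)"
  have K3: "K3 > 0" using K12 by (simp add: K3_def)
  define \<eta> where "\<eta> = \<omega> / K3"
  have \<eta>: "\<eta> > 0" using \<omega> K3 by (simp add: \<eta>_def)
  obtain r where r: "r > 0" and rW: "\<And>x. norm (x - z) < r \<Longrightarrow> norm (W x - n - B (x - z)) \<le> \<eta> * norm (x - z)"
    using B \<eta> unfolding has_derivative_at_alt Wz by meson
  \<comment> \<open>\<open>t \<le> \<eta>\<close> turns errors of order t^3 into eta t^2. The bounds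
    by \<open>\<rho>\<close> and \<open>r\<close> keep the curve and its nearest points, all within
    2 G t of \<open>z\<close>, where the hypotheses apply. The last bound defeats the quadratic
    estimate \<open>exterior\<close>; 81 is the square of 9, a bound for 2 pi + 1.\<close>
  define t where "t = min (min 1 \<eta>) (min (min (\<rho> / (4 * G)) (r / (4 * G))) (1 / (81 * \<bar>C\<bar> * \<omega> + 1)))"
  have pos64: "81 * \<bar>C\<bar> * \<omega> + 1 > 0" using \<omega> by (auto intro: add_nonneg_pos)
  have t: "t > 0" using \<eta> \<open>\<rho> > 0\<close> G r pos64 by (simp add: t_def)
  have t1: "t \<le> 1" and t\<eta>: "t \<le> \<eta>" by (auto simp: t_def)
  have "t \<le> \<rho> / (4 * G)" "t \<le> r / (4 * G)" by (auto simp: t_def)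
  then have t\<rho>: "2 * (G * t) < \<rho>" and tr: "2 * (G * t) < r" using G \<open>\<rho> > 0\<close> r t by (auto simp: field_simps)
  have tC: "t * (81 * \<bar>C\<bar> * \<omega>) < 1"
  proof -
    have "t \<le> 1 / (81 * \<bar>C\<bar> * \<omega> + 1)" by (auto simp: t_def)
    then have "t * (81 * \<bar>C\<bar> * \<omega> + 1) \<le> 1" using pos64 by (simp add: field_simps)
    then show ?thesis using t by (simp add: algebra_simps)
  qed
  have tt: "t * t \<le> t" using t t1 by (simp add: mult_left_le)

  (* h is chosen with h' = - c' . B c, so that gamma' is orthogonal to W up to o(t^2); the symmetric part
     of B contributes the exact term - c . B c / 2, the antisymmetric part the enclosed area. *)
  define c where "c s = t *\<^sub>R ((cos s - 1) *\<^sub>R a + sin s *\<^sub>R b)" for s :: real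
  define c' where "c' s = t *\<^sub>R (- sin s *\<^sub>R a + cos s *\<^sub>R b)" for s :: real
  define h where "h s = - (1/2) * (c s \<bullet> B (c s)) + \<omega> * t\<^sup>2 * (s - sin s)" for s
  define h' where "h' s = - (c' s \<bullet> B (c s))" for s
  define \<gamma> where "\<gamma> s = z + c s + h s *\<^sub>R n" for s
  define \<gamma>' where "\<gamma>' s = c' s + h' s *\<^sub>R n" for s

  \<comment> \<open>Velocity and size of the curve\<close>
  have c_deriv: "(c has_vector_derivative c' s) (at s)" for s
    unfolding c_def c'_def by (auto intro!: derivative_eq_intros)
  have h_deriv: "(h has_vector_derivative h' s) (at s)" for s
  proof -
    have "(c has_derivative (\<lambda>d. d *\<^sub>R c' s)) (at s)"
      using c_deriv[of s] unfolding has_vector_derivative_def .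
    moreover from has_derivative_compose[OF this bounded_linear_imp_has_derivative[OF bl]]
    have "((\<lambda>s. B (c s)) has_derivative (\<lambda>d. B (d *\<^sub>R c' s))) (at s)" .
    ultimately have "(h has_derivative (\<lambda>d. - (1/2) * (c s \<bullet> B (d *\<^sub>R c' s) + (d *\<^sub>R c' s) \<bullet> B (c s))
        + \<omega> * t\<^sup>2 * (d - cos s * d))) (at s)"
      unfolding h_def by (auto intro!: derivative_eq_intros simp: fun_eq_iff field_simps)
    then have "(h has_derivative (\<lambda>d. d *\<^sub>R (- (1/2) * (c s \<bullet> B (c' s) + c' s \<bullet> B (c s)) + \<omega> * t\<^sup>2 * (1 - cos s)))) (at s)"
      by (simp add: linear_cmul[OF lin] algebra_simps)
    moreover have "- (1/2) * (c s \<bullet> B (c' s) + c' s \<bullet> B (c s)) + \<omega> * t\<^sup>2 * (1 - cos s) = h' s"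
    proof -
      \<comment> \<open>The symmetric part of \<open>B\<close> cancels here. The factor t^2 (1 - cos
        s) is the signed area form of \<open>c\<close> and \<open>c'\<close>, and its integral from
        0 is the t^2 (s - sin s) in \<open>h\<close>.\<close>
      have "c s \<bullet> B (c' s) - c' s \<bullet> B (c s) = t\<^sup>2 * ((cos s - 1) * cos s + sin s * sin s) * (a \<bullet> B b - b \<bullet> B a)"
        by (simp add: c_def c'_def linear_cmul[OF lin] linear_add[OF lin] linear_diff[OF lin]
            inner_add_left inner_add_right inner_diff_left inner_diff_right power2_eq_square algebra_simps
            del: sin_cos_squared_add sin_cos_squared_add2 sin_cos_squared_add3)
      also have "(cos s - 1) * cos s + sin s * sin s = 1 - cos s"
        using sin_cos_squared_add[of s] by (simp add: power2_eq_square algebra_simps)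
      also have "a \<bullet> B b - b \<bullet> B a = 2 * \<omega>" by (simp add: \<omega>_def)
      finally have "c s \<bullet> B (c' s) = c' s \<bullet> B (c s) + t\<^sup>2 * (1 - cos s) * (2 * \<omega>)"
        by simp
      then show ?thesis unfolding h'_def by (simp add: algebra_simps)
    qed
    ultimately show ?thesis unfolding has_vector_derivative_def by (simp only:)
  qed
  have \<gamma>_deriv: "(\<gamma> has_vector_derivative \<gamma>' s) (at s)" for s
  proof -
    have "((\<lambda>s. z + c s) has_vector_derivative 0 + c' s) (at s)"
      by (rule has_vector_derivative_add[OF has_vector_derivative_const c_deriv])
    moreover have "((\<lambda>s. h s *\<^sub>R n) has_vector_derivative h' s *\<^sub>R n) (at s)"
      by (rule bounded_linear.has_vector_derivative[OF bounded_linear_scaleR_left h_deriv])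
    ultimately show ?thesis
      unfolding \<gamma>_def \<gamma>'_def using has_vector_derivative_add by fastforce
  qed
  have c'n: "c' s \<bullet> n = 0" for s by (simp add: c'_def an bn inner_diff_left inner_add_left)
  have norm_c': "norm (c' s) \<le> t * N" for s
  proof -
    have "norm (- sin s *\<^sub>R a + cos s *\<^sub>R b) \<le> \<bar>sin s\<bar> * norm a + \<bar>cos s\<bar> * norm b"
      by (metis norm_triangle_ineq norm_scaleR abs_minus)
    also have "\<dots> \<le> 1 * norm a + 1 * norm b" by (intro add_mono mult_right_mono) auto
    also have "\<dots> \<le> N" by (simp add: N_def)
    finally show ?thesis using t by (simp add: c'_def)
  qed
  have norm_c: "norm (c s) \<le> t * (2 * N)" for s
  proof -
    have "norm ((cos s - 1) *\<^sub>R a + sin s *\<^sub>R b) \<le> \<bar>cos s - 1\<bar> * norm a + \<bar>sin s\<bar> * norm b"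
      by (metis norm_triangle_ineq norm_scaleR)
    also have "\<dots> \<le> 2 * norm a + 2 * norm b"
    proof (intro add_mono mult_right_mono)
      show "\<bar>cos s - 1\<bar> \<le> 2" using cos_ge_minus_one[of s] cos_le_one[of s] by linarith
      show "\<bar>sin s\<bar> \<le> 2" using abs_sin_le_one[of s] by linarith
    qed auto
    also have "\<dots> \<le> 2 * N" by (simp add: N_def)
    finally show ?thesis using t by (simp add: c_def)
  qed
  have abs_h: "\<bar>h s\<bar> \<le> H * t\<^sup>2" if "0 \<le> s" "s \<le> 2 * pi" for s
  proof -
    have "\<bar>c s \<bullet> B (c s)\<bar> \<le> norm (c s) * (M * norm (c s))"
      by (meson Cauchy_Schwarz_ineq2 M(2) mult_left_mono norm_ge_zero order_trans)
    also have "\<dots> \<le> (t * (2 * N)) * (M * (t * (2 * N)))"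
      using norm_c[of s] M t N by (intro mult_mono) auto
    finally have 1: "\<bar>c s \<bullet> B (c s)\<bar> \<le> 4 * M * N\<^sup>2 * t\<^sup>2" by (simp add: power2_eq_square mult_ac)
    have "\<bar>s - sin s\<bar> \<le> 9" using that pi_less_4 abs_sin_le_one[of s] by linarith
    then have 2: "\<omega> * t\<^sup>2 * \<bar>s - sin s\<bar> \<le> \<omega> * t\<^sup>2 * 9"
      using \<omega> by (intro mult_left_mono) auto
    have "\<bar>h s\<bar> \<le> (1/2) * \<bar>c s \<bullet> B (c s)\<bar> + \<omega> * t\<^sup>2 * \<bar>s - sin s\<bar>"
      unfolding h_def using \<omega> abs_triangle_ineq[of "- (1/2) * (c s \<bullet> B (c s))" "\<omega> * t\<^sup>2 * (s - sin s)"]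
      by (simp add: abs_mult)
    also have "\<dots> \<le> H * t\<^sup>2" using 1 2 by (simp add: H_def algebra_simps)
    finally show ?thesis .
  qed
  have norm_\<gamma>: "norm (\<gamma> s - z) \<le> G * t" if "0 \<le> s" "s \<le> 2 * pi" for s
  proof -
    have "norm (\<gamma> s - z) \<le> norm (c s) + \<bar>h s\<bar>"
      using norm_triangle_ineq[of "c s" "h s *\<^sub>R n"] \<open>norm n = 1\<close> by (simp add: \<gamma>_def add.assoc)
    also have "\<dots> \<le> t * (2 * N) + H * t"
      using norm_c[of s] abs_h[OF that] tt H
      by (smt (verit) mult_left_mono power2_eq_square)
    finally show ?thesis by (simp add: G_def algebra_simps)
  qed

  \<comment> \<open>Distance from the curve to Z\<close>
  define e where "e = K2 * \<eta> * t\<^sup>2"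
  have e: "e > 0" using K12 \<eta> t by (simp add: e_def)
  define f where "f s = (infdist (\<gamma> s) Z)\<^sup>2" for s
  \<comment> \<open>The start value is positive although \<open>f 0 = 0\<close>: at a crossing the
    distance d is then at least \<open>e\<close>, so d (K1 d + e) is at most (K1 + 1) d^2, and the
    rate K = 2 (K1 + 1) + 1 exceeds what twice this bound needs.\<close>
  define p where "p s = e\<^sup>2 * exp (K * s)" for s :: real
  have "f (2 * pi) \<le> p (2 * pi)"
  proof (rule first_crossing_comparison[where f = f and p = p and T = "2 * pi" and s = "2 * pi"])
    have "continuous_on {0..2 * pi} \<gamma>"
      using \<gamma>_deriv by (meson continuous_at_imp_continuous_on has_vector_derivative_continuous)
    then show "continuous_on {0..2 * pi} f"
      unfolding f_def by (intro continuous_on_power continuous_on_infdist)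
    show "continuous_on {0..2 * pi} p" unfolding p_def by (intro continuous_intros)
    have "\<gamma> 0 = z" by (simp add: \<gamma>_def h_def c_def linear_0[OF lin])
    then show "f 0 \<le> p 0" using \<open>z \<in> Z\<close> by (simp add: f_def p_def)
  next
    fix s assume s: "0 \<le> s" "s < 2 * pi" and eq: "f s = p s"
    obtain x where x: "x \<in> Z" "infdist (\<gamma> s) Z = dist (\<gamma> s) x"
      using infdist_attains_inf[OF \<open>closed Z\<close>] \<open>z \<in> Z\<close> by blast
    have nearest: "dist (\<gamma> s) x \<le> dist (\<gamma> s) x'" if "x' \<in> Z" for x'
      using infdist_le[OF that, of "\<gamma> s"] x(2) by simp
    define d where "d = norm (\<gamma> s - x)"
    have fd: "f s = d\<^sup>2" by (simp add: f_def x(2) d_def dist_norm)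
    have \<gamma>z: "norm (\<gamma> s - z) \<le> G * t" using norm_\<gamma> s by simp
    have "d \<le> G * t" using nearest[OF \<open>z \<in> Z\<close>] \<gamma>z by (simp add: d_def dist_norm)
    then have xz: "norm (x - z) \<le> 2 * (G * t)"
      using norm_triangle_ineq[of "x - \<gamma> s" "\<gamma> s - z"] \<gamma>z by (simp add: d_def norm_minus_commute)
    have xr: "dist z x < \<rho>" "norm (x - z) < r"
      using xz t\<rho> tr by (auto simp: dist_norm norm_minus_commute)
    have "dist z (\<gamma> s) < \<rho>"
      using \<gamma>z t\<rho> G t by (simp add: dist_norm norm_minus_commute) (smt (verit) mult_pos_pos)
    from normal[OF x(1) xr(1) this nearest] obtain k where k: "\<gamma> s - x = k *\<^sub>R W x" by blast
    have "\<bar>k\<bar> \<le> d"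
    proof -
      have "1 \<le> norm (W x)"
        using Wn[OF xr(1)] Cauchy_Schwarz_ineq2[of n "W x"] \<open>norm n = 1\<close> by simp
      then have "\<bar>k\<bar> * 1 \<le> \<bar>k\<bar> * norm (W x)" by (intro mult_left_mono) auto
      then show ?thesis by (simp add: d_def k)
    qed
    (* gamma - x is parallel to W x, whose n-component is 1, so only the defect of gamma' from
       the hyperplane orthogonal to W x enters. *)
    have "(\<gamma> s - x) \<bullet> \<gamma>' s = k * (c' s \<bullet> W x + h' s)"
      using Wn[OF xr(1)] by (simp add: k \<gamma>'_def inner_add_right inner_commute algebra_simps)
    \<comment> \<open>Because \<open>c'\<close> is orthogonal to \<open>n\<close> and h' is minus
      \<open>c' \<bullet> B c\<close>, the defect splits into the expansion error of
      \<open>W\<close> at \<open>x\<close> and \<open>B\<close> applied to (x - z) - c, which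
      consists of the offset from the curve and the height.\<close>
    also have "c' s \<bullet> W x + h' s = c' s \<bullet> (W x - n - B (x - z)) + c' s \<bullet> B (x - \<gamma> s + h s *\<^sub>R n)"
    proof -
      have v: "x - \<gamma> s + h s *\<^sub>R n = (x - z) - c s" by (simp add: \<gamma>_def)
      show ?thesis
        unfolding v by (simp add: linear_diff[OF lin] h'_def inner_diff_right c'n)
    qed
    also have "k * \<dots> \<le> d * (K1 * d + e)"
    proof -
      have 1: "\<bar>c' s \<bullet> (W x - n - B (x - z))\<bar> \<le> (t * N) * (\<eta> * (2 * (G * t)))"
      proof -
        have "norm (W x - n - B (x - z)) \<le> \<eta> * (2 * (G * t))"
          using rW[OF xr(2)] xz \<eta> by (meson mult_left_mono less_imp_le order_trans)
        then have "norm (c' s) * norm (W x - n - B (x - z)) \<le> (t * N) * (\<eta> * (2 * (G * t)))"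
          using norm_c' t N by (intro mult_mono) auto
        then show ?thesis using Cauchy_Schwarz_ineq2 order_trans by blast
      qed
      have 2: "\<bar>c' s \<bullet> B (x - \<gamma> s + h s *\<^sub>R n)\<bar> \<le> N * (M * (d + H * (\<eta> * t\<^sup>2)) )"
      proof -
        have nv: "norm (x - \<gamma> s + h s *\<^sub>R n) \<le> d + \<bar>h s\<bar>"
          using norm_triangle_ineq[of "x - \<gamma> s" "h s *\<^sub>R n"] \<open>norm n = 1\<close>
          by (simp add: d_def norm_minus_commute)
        have "norm (c' s) * norm (B (x - \<gamma> s + h s *\<^sub>R n)) \<le> (t * N) * (M * (d + H * t\<^sup>2))"
        proof (intro mult_mono norm_c')
          have "norm (x - \<gamma> s + h s *\<^sub>R n) \<le> d + H * t\<^sup>2" using nv abs_h[of s] s by simp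
          then show "norm (B (x - \<gamma> s + h s *\<^sub>R n)) \<le> M * (d + H * t\<^sup>2)"
            using M by (meson mult_left_mono less_imp_le order_trans)
        qed (use t N in auto)
        also have "\<dots> = N * (M * (t * d + H * (t * t\<^sup>2)))" by (simp add: algebra_simps)
        also have "\<dots> \<le> N * (M * (d + H * (\<eta> * t\<^sup>2)))"
        proof -
          have "t * d \<le> 1 * d" by (rule mult_right_mono[OF t1]) (simp add: d_def)
          moreover have "t * t\<^sup>2 \<le> \<eta> * t\<^sup>2" by (rule mult_right_mono[OF t\<eta>]) simp
          ultimately show ?thesis using N M H by (intro mult_left_mono add_mono) auto
        qed
        finally show ?thesis using Cauchy_Schwarz_ineq2 order_trans by blast
      qed
      have "\<bar>c' s \<bullet> (W x - n - B (x - z)) + c' s \<bullet> B (x - \<gamma> s + h s *\<^sub>R n)\<bar> \<le> K1 * d + e"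
        using 1 2 by (simp add: K1_def e_def K2_def power2_eq_square algebra_simps)
      then have "\<bar>k\<bar> * \<bar>c' s \<bullet> (W x - n - B (x - z)) + c' s \<bullet> B (x - \<gamma> s + h s *\<^sub>R n)\<bar> \<le> d * (K1 * d + e)"
        using \<open>\<bar>k\<bar> \<le> d\<close> by (intro mult_mono) (auto simp: d_def)
      then show ?thesis by (metis abs_le_D1 abs_mult)
    qed
    finally have main: "(\<gamma> s - x) \<bullet> \<gamma>' s \<le> d * (K1 * d + e)" .
    define q where "q s' = (\<gamma> s' - x) \<bullet> (\<gamma> s' - x)" for s'
    have "DERIV q s :> 2 * ((\<gamma> s - x) \<bullet> \<gamma>' s)"
    proof -
      have "(\<gamma> has_derivative (\<lambda>d. d *\<^sub>R \<gamma>' s)) (at s)"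
        using \<gamma>_deriv[of s] unfolding has_vector_derivative_def .
      from has_derivative_diff[OF this has_derivative_const, of x]
      have "((\<lambda>s. \<gamma> s - x) has_derivative (\<lambda>d. d *\<^sub>R \<gamma>' s)) (at s)"
        by (simp only: diff_0_right)
      from has_derivative_inner[OF this this]
      have "(q has_derivative (\<lambda>d. (\<gamma> s - x) \<bullet> (d *\<^sub>R \<gamma>' s) + (d *\<^sub>R \<gamma>' s) \<bullet> (\<gamma> s - x))) (at s)"
        unfolding q_def .
      moreover have "(\<lambda>d. (\<gamma> s - x) \<bullet> (d *\<^sub>R \<gamma>' s) + (d *\<^sub>R \<gamma>' s) \<bullet> (\<gamma> s - x))
          = (*) (2 * ((\<gamma> s - x) \<bullet> \<gamma>' s))"
      proof (rule ext)
        fix y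
        have "(\<gamma> s - x) \<bullet> (y *\<^sub>R \<gamma>' s) + (y *\<^sub>R \<gamma>' s) \<bullet> (\<gamma> s - x) = y * X + y * X"
          if "X = (\<gamma> s - x) \<bullet> \<gamma>' s" for X
          by (simp only: that inner_commute[of "y *\<^sub>R \<gamma>' s"] inner_scaleR_right)
        then show "(\<gamma> s - x) \<bullet> (y *\<^sub>R \<gamma>' s) + (y *\<^sub>R \<gamma>' s) \<bullet> (\<gamma> s - x) = 2 * ((\<gamma> s - x) \<bullet> \<gamma>' s) * y"
          by simp
      qed
      ultimately show ?thesis unfolding has_field_derivative_def by (rule subst[rotated])
    qed
    moreover have "DERIV p s :> K * p s"
    proof -
      have "((\<lambda>s. K * s) has_real_derivative K) (at s)" by (auto intro!: derivative_eq_intros)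
      from DERIV_cmult[OF DERIV_fun_exp[OF this], of "e\<^sup>2"] show ?thesis
        unfolding p_def by (simp only: mult_ac)
    qed
    ultimately have "DERIV (\<lambda>s. q s - p s) s :> 2 * ((\<gamma> s - x) \<bullet> \<gamma>' s) - K * p s"
      by (rule DERIV_diff)
    moreover have "2 * ((\<gamma> s - x) \<bullet> \<gamma>' s) - K * p s < 0"
    proof -
      have K0: "K > 0" using K12 by (simp add: K_def)
      have pd: "p s = d\<^sup>2" using eq fd by simp
      have "1 \<le> exp (K * s)" using K0 s by simp
      then have "e\<^sup>2 * 1 \<le> p s" unfolding p_def by (intro mult_left_mono) auto
      then have "e\<^sup>2 \<le> d\<^sup>2" by (simp only: pd mult_1_right)
      then have ed: "e \<le> d" by (rule power2_le_imp_le) (simp add: d_def)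
      have "d * (K1 * d + e) \<le> d * (K1 * d + d)"
        using ed by (intro mult_left_mono) (auto simp: d_def)
      also have "\<dots> = (K1 + 1) * d\<^sup>2" by (simp add: power2_eq_square algebra_simps)
      finally have "2 * ((\<gamma> s - x) \<bullet> \<gamma>' s) \<le> 2 * ((K1 + 1) * d\<^sup>2)" using main by linarith
      moreover have "d\<^sup>2 > 0" using ed e by simp
      moreover have "K * p s = 2 * ((K1 + 1) * d\<^sup>2) + d\<^sup>2"
        unfolding pd K_def by (simp add: algebra_simps)
      ultimately show ?thesis by linarith
    qed
    moreover have "q s = f s" by (simp add: q_def fd d_def dot_square_norm)
    moreover have "f s' \<le> q s'" for s'
    proof -
      have "infdist (\<gamma> s') Z \<le> norm (\<gamma> s' - x)" using infdist_le[OF x(1), of "\<gamma> s'"] by (simp add: dist_norm)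
      then show ?thesis by (simp add: f_def q_def dot_square_norm infdist_nonneg power_mono)
    qed
    ultimately show "\<exists>q D. q s = f s \<and> (\<forall>s'. f s' \<le> q s') \<and> DERIV (\<lambda>s. q s - p s) s :> D \<and> D < 0"
      by blast
  qed auto
  also have "p (2 * pi) = (\<omega> * t\<^sup>2)\<^sup>2"
  proof -
    have "exp (K * (2 * pi)) = (exp (pi * K))\<^sup>2"
      unfolding power2_eq_square exp_add[symmetric] by (rule arg_cong[where f = exp]) simp
    then have "p (2 * pi) = (e * exp (pi * K))\<^sup>2" by (simp add: p_def power_mult_distrib)
    moreover have "e * exp (pi * K) = \<omega> * t\<^sup>2" using K12 by (simp add: e_def \<eta>_def K3_def)
    ultimately show ?thesis by simp
  qed
  finally have "(infdist (\<gamma> (2 * pi)) Z)\<^sup>2 \<le> (\<omega> * t\<^sup>2)\<^sup>2" by (simp only: f_def)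
  then have end_near: "infdist (\<gamma> (2 * pi)) Z \<le> \<omega> * t\<^sup>2"
    by (rule power2_le_imp_le) (use \<omega> in simp)

  \<comment> \<open>The end point of the curve against the exterior ball\<close>
  obtain x where x: "x \<in> Z" "infdist (\<gamma> (2 * pi)) Z = dist (\<gamma> (2 * pi)) x"
    using infdist_attains_inf[OF \<open>closed Z\<close>] \<open>z \<in> Z\<close> by blast
  have x_near: "norm (x - \<gamma> (2 * pi)) \<le> \<omega> * t\<^sup>2"
    using end_near unfolding x(2) dist_norm norm_minus_commute[of x] .
  \<comment> \<open>The end point lies exactly 2 pi m beyond \<open>z\<close> along
    \<open>n\<close>, and a point of Z lies within m of it. That point has component at least m
    along \<open>n\<close> and distance at most 9 m from \<open>z\<close>, so
    \<open>exterior\<close> would force m to be at most 81 |C| m^2.\<close>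
  define m where "m = \<omega> * t\<^sup>2"
  have m: "m > 0" using \<omega> t by (simp add: m_def)
  have "\<gamma> (2 * pi) = z + (2 * pi * m) *\<^sub>R n"
    by (simp add: \<gamma>_def h_def c_def linear_0[OF lin] m_def mult_ac)
  then have xz: "x - z = (2 * pi * m) *\<^sub>R n + (x - \<gamma> (2 * pi))" by simp
  have "n \<bullet> (x - z) = 2 * pi * m + n \<bullet> (x - \<gamma> (2 * pi))"
    by (subst xz) (simp add: inner_add_right dot_square_norm \<open>norm n = 1\<close>)
  moreover have "\<bar>n \<bullet> (x - \<gamma> (2 * pi))\<bar> \<le> m"
    using Cauchy_Schwarz_ineq2[of n "x - \<gamma> (2 * pi)"] x_near \<open>norm n = 1\<close> by (simp add: m_def)
  moreover have "2 * m \<le> 2 * pi * m"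
    using m pi_gt3 by (intro mult_right_mono) auto
  ultimately have low: "m \<le> n \<bullet> (x - z)" by linarith
  have "norm (x - z) \<le> 2 * pi * m + m"
    by (subst xz, rule norm_triangle_le) (use x_near m \<open>norm n = 1\<close> in \<open>simp add: m_def\<close>)
  also have "\<dots> \<le> 9 * m"
  proof -
    have "2 * pi * m \<le> 8 * m" using m pi_less_4 by (intro mult_right_mono) auto
    then show ?thesis by simp
  qed
  finally have "(norm (x - z))\<^sup>2 \<le> (9 * m)\<^sup>2" by (intro power_mono) auto
  then have "\<bar>C\<bar> * (norm (x - z))\<^sup>2 \<le> \<bar>C\<bar> * (9 * m)\<^sup>2" by (intro mult_left_mono) auto
  moreover have "C * (norm (x - z))\<^sup>2 \<le> \<bar>C\<bar> * (norm (x - z))\<^sup>2" by (intro mult_right_mono) auto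
  ultimately have "m \<le> \<bar>C\<bar> * (9 * m)\<^sup>2"
    using exterior[OF x(1)] low by linarith
  also have "\<dots> = m * (81 * \<bar>C\<bar> * m)" by (simp add: power2_eq_square)
  finally have "1 \<le> 81 * \<bar>C\<bar> * m" using m by simp
  also have "81 * \<bar>C\<bar> * m \<le> 81 * \<bar>C\<bar> * (\<omega> * t)"
    using tt \<omega> by (intro mult_left_mono) (auto simp: m_def power2_eq_square)
  also have "\<dots> = t * (81 * \<bar>C\<bar> * \<omega>)" by simp
  finally show False using tC by simp
qed

subsection \<open>The operator H and the curl matrix\<close>

lemma has_derivative_gradient:
  fixes u :: "real^'m \<Rightarrow> real"
  assumes "u differentiable (at x)"
  shows "(u has_derivative (\<lambda>d. gradient u x \<bullet> d)) (at x)"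
proof -
  have D: "(u has_derivative frechet_derivative u (at x)) (at x)"
    using assms frechet_derivative_works by blast
  then have lin: "linear (frechet_derivative u (at x))" by (rule has_derivative_linear)
  have "frechet_derivative u (at x) d = gradient u x \<bullet> d" for d
  proof -
    have "frechet_derivative u (at x) d = frechet_derivative u (at x) (\<Sum>i\<in>UNIV. d $ i *\<^sub>R axis i 1)"
      using basis_expansion[of d] by (simp add: scalar_mult_eq_scaleR)
    also have "\<dots> = (\<Sum>i\<in>UNIV. d $ i * gradient u x $ i)"
      by (simp add: linear_sum[OF lin] linear_cmul[OF lin] gradient_def)
    also have "\<dots> = gradient u x \<bullet> d" by (simp add: inner_vec_def mult.commute)
    finally show ?thesis .
  qed
  then show ?thesis using D by presburger
qed

lemma divergence_eq_sum_Basis: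
  fixes f :: "real^'m \<Rightarrow> real^'m"
  assumes "(f has_derivative D) (at x)"
  shows "divergence f x = (\<Sum>b\<in>Basis. b \<bullet> D b)"
proof -
  have Basis: "(Basis :: (real^'m) set) = range (\<lambda>i. axis i 1)" by (auto simp: Basis_vec_def)
  have inj: "inj (\<lambda>i. axis i (1::real) :: real^'m)" by (auto simp: inj_on_def axis_eq_axis)
  have "frechet_derivative f (at x) = D" using frechet_derivative_at[OF assms] by simp
  then show ?thesis
    unfolding divergence_def jacobian_def Basis sum.reindex[OF inj]
    by (simp add: matrix_def inner_axis' )
qed

text \<open>Differentiating 1/|V| produces minus (V . J V)/|V|^3, which is precisely the normal term
  subtracted in \<open>tangential_trace\<close>.\<close>

lemma divergence_normalized_field:
  fixes V :: "real^'m \<Rightarrow> real^'m"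
  assumes V: "(V has_derivative J) (at x)" and "V x \<noteq> 0"
  shows "divergence (\<lambda>x. V x /\<^sub>R norm (V x)) x = tangential_trace (V x) J / norm (V x)"
proof -
  have lin: "linear J" using V by (rule has_derivative_linear)
  define r where "r = norm (V x)"
  have r: "r > 0" using assms by (simp add: r_def)
  have "((\<lambda>x. norm (V x)) has_derivative (\<lambda>h. J h \<bullet> sgn (V x))) (at x)"
    using has_derivative_compose[OF V has_derivative_norm[OF \<open>V x \<noteq> 0\<close>]] .
  from has_derivative_scaleR[OF Deriv.has_derivative_inverse[OF _ this] V]
  have "((\<lambda>x. V x /\<^sub>R norm (V x)) has_derivative
      (\<lambda>h. inverse r *\<^sub>R J h + (- (inverse r * (J h \<bullet> sgn (V x)) * inverse r)) *\<^sub>R V x)) (at x)"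
    using assms by (simp add: r_def)
  from divergence_eq_sum_Basis[OF this]
  have "divergence (\<lambda>x. V x /\<^sub>R norm (V x)) x
     = inverse r * (\<Sum>b\<in>Basis. b \<bullet> J b) - inverse r ^ 3 * (\<Sum>b\<in>Basis. (J b \<bullet> V x) * (b \<bullet> V x))"
    by (simp add: inner_diff_right sum_subtractf sum_distrib_left sgn_div_norm r_def[symmetric] power3_eq_cube
        sum_negf mult_ac)
  also have "(\<Sum>b\<in>Basis. (J b \<bullet> V x) * (b \<bullet> V x)) = J (\<Sum>b\<in>Basis. (V x \<bullet> b) *\<^sub>R b) \<bullet> V x"
    by (simp add: linear_sum[OF lin] linear_cmul[OF lin] inner_sum_left inner_commute[of "V x"] mult.commute)
  also have "(\<Sum>b\<in>Basis. (V x \<bullet> b) *\<^sub>R b) = V x" by (rule euclidean_representation)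
  also have "inverse r * (\<Sum>b\<in>Basis. b \<bullet> J b) - inverse r ^ 3 * (J (V x) \<bullet> V x) = tangential_trace (V x) J / r"
    using r by (simp add: tangential_trace_def dot_square_norm r_def[symmetric] power2_eq_square
        power3_eq_cube inner_commute field_simps)
  finally show ?thesis by (simp add: r_def)
qed

text \<open>\<open>A\<close> maps the complement of \<open>n\<close> into the line of
  \<open>n\<close>, so its range is spanned by \<open>n\<close> and \<open>A *v n\<close>.\<close>

lemma rank_le_2_if_hyperplane_form_zero:
  fixes A :: "real^'m^'m" and n :: "real^'m"
  assumes "norm n = 1"
    and zero: "\<And>a b. a \<bullet> n = 0 \<Longrightarrow> b \<bullet> n = 0 \<Longrightarrow> a \<bullet> (A *v b) = 0"
  shows "rank A \<le> 2"
proof -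
  have nn: "n \<bullet> n = 1" using \<open>norm n = 1\<close> by (simp add: dot_square_norm)
  have "A *v x \<in> span {n, A *v n}" for x
  proof -
    define b where "b = x - (x \<bullet> n) *\<^sub>R n"
    have b: "b \<bullet> n = 0" using nn by (simp add: b_def inner_diff_left)
    \<comment> \<open>The part of the image orthogonal to \<open>n\<close> is itself an admissible
      test vector; testing with it shows that it vanishes.\<close>
    define a where "a = A *v b - ((A *v b) \<bullet> n) *\<^sub>R n"
    have a: "a \<bullet> n = 0" using nn by (simp add: a_def inner_diff_left)
    have "a \<bullet> a = a \<bullet> (A *v b) - ((A *v b) \<bullet> n) * (a \<bullet> n)"
      by (subst (2) a_def) (simp add: inner_diff_right)
    then have "a \<bullet> a = 0" using zero[OF a b] a by simp
    then have "A *v b = ((A *v b) \<bullet> n) *\<^sub>R n" by (simp add: a_def)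
    moreover have "x = b + (x \<bullet> n) *\<^sub>R n" by (simp add: b_def)
    ultimately have "A *v x = ((A *v b) \<bullet> n) *\<^sub>R n + (x \<bullet> n) *\<^sub>R (A *v n)"
      by (metis matrix_vector_right_distrib matrix_vector_mult_scaleR)
    then show ?thesis by (simp add: span_add span_base span_mul)
  qed
  then have "range ((*v) A) \<subseteq> span {n, A *v n}" by auto
  then have "dim (range ((*v) A)) \<le> card {n, A *v n}" by (intro dim_le_card) auto
  also have "\<dots> \<le> 2" by (simp add: card_insert_if)
  finally show ?thesis by (simp add: rank_dim_range)
qed

text \<open>With the coefficients of \<open>u\<close> used for both fields, the Jacobian of
  \<open>F\<close> cancels and the difference of the Hessians remains. Changing the coefficients of
  the \<open>v\<close> term costs a multiple of |grad u - grad v|. Compactness of a closed ball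
  supplies the constants: \<open>c\<close> below both field norms, \<open>K\<close> for the
  derivative of the field of \<open>v\<close>, and \<open>R\<close> for clearing the
  denominator.\<close>

lemma local_gradient_inequality:
  fixes U :: "(real^'m) set" and F :: "real^'m \<Rightarrow> real^'m"
  assumes "open U" "C1_on U F" "C2_on U u" "C2_on U v" "z \<in> U"
    and Vu: "\<And>x. x \<in> U \<Longrightarrow> gradient u x + F x \<noteq> 0"
    and Vv: "\<And>x. x \<in> U \<Longrightarrow> gradient v x + F x \<noteq> 0"
    and H: "\<And>x. x \<in> U \<Longrightarrow> H_op F u x \<le> H_op F v x"
  obtains \<delta> C where "\<delta> > 0" "ball z \<delta> \<subseteq> U"
    "\<And>x. x \<in> ball z \<delta> \<Longrightarrow>
      tangential_trace (gradient u x + F x)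
        (\<lambda>d. jacobian (gradient u) (at x) *v d - jacobian (gradient v) (at x) *v d)
      \<le> C * norm (gradient u x - gradient v x)"
proof -
  obtain \<delta> where \<delta>: "\<delta> > 0" "cball z \<delta> \<subseteq> U"
    using \<open>open U\<close> \<open>z \<in> U\<close> open_contains_cball by blast
  let ?B = "cball z \<delta>"
  have dF: "(F has_derivative (\<lambda>d. jacobian F (at x) *v d)) (at x)" if "x \<in> U" for x
    using assms(2) that by (auto simp: C1_on_def jacobian_works)
  have du: "(gradient u has_derivative (\<lambda>d. jacobian (gradient u) (at x) *v d)) (at x)" if "x \<in> U" for x
    using assms(3) that by (auto simp: C1_on_def C2_on_def jacobian_works)
  have dv: "(gradient v has_derivative (\<lambda>d. jacobian (gradient v) (at x) *v d)) (at x)" if "x \<in> U" for x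
    using assms(4) that by (auto simp: C1_on_def C2_on_def jacobian_works)
  define P where "P x = gradient u x + F x" for x
  define Q where "Q x = gradient v x + F x" for x
  have dP: "(P has_derivative (\<lambda>d. jacobian (gradient u) (at x) *v d + jacobian F (at x) *v d)) (at x)" if "x \<in> U" for x
    unfolding P_def by (rule has_derivative_add[OF du[OF that] dF[OF that]])
  have dQ: "(Q has_derivative (\<lambda>d. jacobian (gradient v) (at x) *v d + jacobian F (at x) *v d)) (at x)" if "x \<in> U" for x
    unfolding Q_def by (rule has_derivative_add[OF dv[OF that] dF[OF that]])
  have contP: "continuous_on ?B P"
    by (rule continuous_at_imp_continuous_on) (use has_derivative_continuous[OF dP] \<delta>(2) in auto)
  have contQ: "continuous_on ?B Q"
    by (rule continuous_at_imp_continuous_on) (use has_derivative_continuous[OF dQ] \<delta>(2) in auto)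
  have ne: "?B \<noteq> {}" using \<delta>(1) by simp
  have "continuous_on ?B (\<lambda>x. min (norm (P x)) (norm (Q x)))"
    by (intro continuous_on_min continuous_on_norm contP contQ)
  from continuous_attains_inf[OF compact_cball ne this]
  obtain x0 where x0: "x0 \<in> ?B" "\<And>x. x \<in> ?B \<Longrightarrow> min (norm (P x0)) (norm (Q x0)) \<le> min (norm (P x)) (norm (Q x))"
    by blast
  define c where "c = min (norm (P x0)) (norm (Q x0))"
  have c: "c > 0" using x0(1) \<delta>(2) Vu[of x0] Vv[of x0] by (auto simp: c_def P_def Q_def)
  have cPQ: "c \<le> norm (P x)" "c \<le> norm (Q x)" if "x \<in> ?B" for x
    using x0(2)[OF that] unfolding c_def by (meson min.boundedE)+
  define M where "M x = jacobian (gradient v) (at x) + jacobian F (at x)" for x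
  \<comment> \<open>The entry sum bounds the operator norm and is visibly continuous, so its maximum
    on the ball is a uniform bound.\<close>
  define S where "S x = (\<Sum>i\<in>UNIV. \<Sum>j\<in>UNIV. \<bar>M x $ i $ j\<bar>)" for x
  have "continuous_on ?B M"
    unfolding M_def
    by (intro continuous_on_add; rule continuous_on_subset[OF _ \<delta>(2)])
      (use assms(2,4) in \<open>auto simp: C1_on_def C2_on_def\<close>)
  then have "continuous_on ?B S"
    unfolding S_def by (intro continuous_on_sum continuous_on_rabs continuous_on_component)
  from continuous_attains_sup[OF compact_cball ne this]
  obtain x1 where x1: "\<And>x. x \<in> ?B \<Longrightarrow> S x \<le> S x1" by blast
  define K where "K = S x1"
  have K: "norm (M x *v d) \<le> K * norm d" if "x \<in> ?B" for x d
  proof -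
    have "norm (M x *v d) \<le> onorm ((*v) (M x)) * norm d"
      by (rule onorm) simp
    also have "\<dots> \<le> S x * norm d"
      unfolding S_def by (intro mult_right_mono onorm_le_matrix_component_sum) simp
    also have "\<dots> \<le> K * norm d"
      using x1[OF that] by (intro mult_right_mono) (auto simp: K_def)
    finally show ?thesis .
  qed
  define k where "k = (DIM(real^'m) + 5) * K / c\<^sup>2"
  obtain R where R: "\<And>x. x \<in> ?B \<Longrightarrow> norm (P x) \<le> R"
    using continuous_attains_sup[OF compact_cball ne continuous_on_norm[OF contP]] by blast
  have K0: "K \<ge> 0" by (simp add: K_def S_def sum_nonneg)
  have main: "tangential_trace (P x) (\<lambda>d. jacobian (gradient u) (at x) *v d - jacobian (gradient v) (at x) *v d)
      \<le> (R * k) * norm (gradient u x - gradient v x)" if x: "x \<in> ?B" for x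
  proof -
    have xU: "x \<in> U" using x \<delta>(2) by blast
    have P0: "norm (P x) > 0" using cPQ(1)[OF x] c by linarith
    have "H_op F u x = tangential_trace (P x) (\<lambda>d. jacobian (gradient u) (at x) *v d + jacobian F (at x) *v d) / norm (P x)"
      using divergence_normalized_field[OF dP[OF xU]] Vu[OF xU]
      by (simp add: H_op_def N_field_def[abs_def] P_def)
    moreover have "H_op F v x = tangential_trace (Q x) (\<lambda>d. jacobian (gradient v) (at x) *v d + jacobian F (at x) *v d) / norm (Q x)"
      using divergence_normalized_field[OF dQ[OF xU]] Vv[OF xU]
      by (simp add: H_op_def N_field_def[abs_def] Q_def)
    moreover have "(\<lambda>d. jacobian (gradient v) (at x) *v d + jacobian F (at x) *v d) = (\<lambda>d. M x *v d)"
      by (simp add: M_def matrix_vector_mult_add_rdistrib)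
    moreover have "tangential_trace (P x) (\<lambda>d. jacobian (gradient u) (at x) *v d - jacobian (gradient v) (at x) *v d)
        = tangential_trace (P x) (\<lambda>d. jacobian (gradient u) (at x) *v d + jacobian F (at x) *v d)
          - tangential_trace (P x) (\<lambda>d. M x *v d)"
      by (simp add: tangential_trace_diff[symmetric] M_def matrix_vector_mult_add_rdistrib)
    ultimately have "tangential_trace (P x) (\<lambda>d. jacobian (gradient u) (at x) *v d - jacobian (gradient v) (at x) *v d) / norm (P x)
        \<le> tangential_trace (Q x) ((*v) (M x)) / norm (Q x) - tangential_trace (P x) ((*v) (M x)) / norm (P x)"
      using H[OF xU] by (simp add: diff_divide_distrib)
    also have "\<dots> \<le> k * norm (P x - Q x)"
      unfolding k_def
      using tangential_trace_Lipschitz[OF matrix_vector_mul_linear K[OF x] c cPQ[OF x]] by linarith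
    also have "P x - Q x = gradient u x - gradient v x" by (simp add: P_def Q_def)
    finally have "tangential_trace (P x) (\<lambda>d. jacobian (gradient u) (at x) *v d - jacobian (gradient v) (at x) *v d)
        \<le> norm (P x) * (k * norm (gradient u x - gradient v x))"
      using P0 by (simp add: pos_divide_le_eq mult.commute)
    also have "\<dots> \<le> R * (k * norm (gradient u x - gradient v x))"
      using R[OF x] K0 by (intro mult_right_mono) (auto simp: k_def)
    finally show ?thesis by (simp add: mult.assoc)
  qed
  show ?thesis
  proof (rule that)
    show "\<delta> > 0" "ball z \<delta> \<subseteq> U" using \<delta> by auto
    show "tangential_trace (gradient u x + F x)
        (\<lambda>d. jacobian (gradient u) (at x) *v d - jacobian (gradient v) (at x) *v d)
      \<le> (R * k) * norm (gradient u x - gradient v x)" if "x \<in> ball z \<delta>" for x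
      using main[of x] that by (simp add: P_def)
  qed
qed

theorem corollaryH:
  fixes U :: "(real^'m) set"
    and F :: "real^'m \<Rightarrow> real^'m"
    and u v :: "real^'m \<Rightarrow> real"
    and p0 :: "real^'m"
  assumes "CARD('m) \<ge> 3"
    and "open U" and "connected U"
    and "C1_on U F" and "C2_on U u" and "C2_on U v"
    and "\<And>x. x \<in> U \<Longrightarrow> gradient u x + F x \<noteq> 0"
    and "\<And>x. x \<in> U \<Longrightarrow> gradient v x + F x \<noteq> 0"
    and "\<And>x. x \<in> U \<Longrightarrow> H_op F u x \<le> H_op F v x"
    and "\<And>x. x \<in> U \<Longrightarrow> u x \<ge> v x"
    and "p0 \<in> U" and "u p0 = v p0"
    and "\<And>x. x \<in> U \<Longrightarrow> rank (curl_matrix F x) \<ge> 3"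
  shows "\<forall>x\<in>U. u x = v x"
proof -
  have dF: "(F has_derivative (\<lambda>d. jacobian F (at x) *v d)) (at x)" if "x \<in> U" for x
    using \<open>C1_on U F\<close> that by (auto simp: C1_on_def jacobian_works)
  have u1: "(u has_derivative (\<lambda>d. gradient u x \<bullet> d)) (at x)" if "x \<in> U" for x
    using \<open>C2_on U u\<close> that by (auto simp: C2_on_def intro: has_derivative_gradient)
  have v1: "(v has_derivative (\<lambda>d. gradient v x \<bullet> d)) (at x)" if "x \<in> U" for x
    using \<open>C2_on U v\<close> that by (auto simp: C2_on_def intro: has_derivative_gradient)
  have u2: "(gradient u has_derivative (\<lambda>d. jacobian (gradient u) (at x) *v d)) (at x)" if "x \<in> U" for x
    using \<open>C2_on U u\<close> that by (auto simp: C1_on_def C2_on_def jacobian_works)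
  have v2: "(gradient v has_derivative (\<lambda>d. jacobian (gradient v) (at x) *v d)) (at x)" if "x \<in> U" for x
    using \<open>C2_on U v\<close> that by (auto simp: C1_on_def C2_on_def jacobian_works)
  have w1: "((\<lambda>x. u x - v x) has_derivative (\<lambda>d. (gradient u x - gradient v x) \<bullet> d)) (at x)" if "x \<in> U" for x
    unfolding inner_diff_left by (rule has_derivative_diff[OF u1[OF that] v1[OF that]])
  have w2: "((\<lambda>x. gradient u x - gradient v x) has_derivative
      (\<lambda>d. jacobian (gradient u) (at x) *v d - jacobian (gradient v) (at x) *v d)) (at x)" if "x \<in> U" for x
    by (rule has_derivative_diff[OF u2[OF that] v2[OF that]])
  define V where "V x = gradient u x + F x" for x
  define J where "J x d = jacobian (gradient u) (at x) *v d + jacobian F (at x) *v d" for x d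
  have dV: "(V has_derivative J x) (at x)" if "x \<in> U" for x
    unfolding V_def J_def by (rule has_derivative_add[OF u2[OF that] dF[OF that]])
  have contV: "continuous_on U V"
    by (rule continuous_at_imp_continuous_on) (use has_derivative_continuous[OF dV] in auto)
  have contw: "continuous_on U (\<lambda>x. u x - v x)"
    by (rule continuous_at_imp_continuous_on) (use has_derivative_continuous[OF w1] in auto)
  define Z where "Z = {x \<in> U. u x = v x}"

  \<comment> \<open>The ball about \<open>y\<close> need only be free of contact points near
    \<open>z\<close>. This local form also applies to nearest points of a piece of \<open>Z\<close>
    cut out by a closed ball.\<close>
  have normal: "collinear {0, V z, y - z}"
    if "z \<in> Z" "\<sigma> > 0" and free: "\<And>x. x \<in> ball z \<sigma> \<Longrightarrow> dist y x < dist y z \<Longrightarrow> x \<notin> Z" for y z \<sigma>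
  proof -
    have "z \<in> U" using \<open>z \<in> Z\<close> by (simp add: Z_def)
    obtain \<delta> C where \<delta>: "\<delta> > 0" "ball z \<delta> \<subseteq> U"
      and ineq: "\<And>x. x \<in> ball z \<delta> \<Longrightarrow> tangential_trace (gradient u x + F x)
        (\<lambda>d. jacobian (gradient u) (at x) *v d - jacobian (gradient v) (at x) *v d)
        \<le> C * norm (gradient u x - gradient v x)"
      using local_gradient_inequality[OF assms(2,4,5,6) \<open>z \<in> U\<close> assms(7,8,9)] by blast
    define S where "S = ball z (min \<delta> \<sigma>)"
    have S: "x \<in> U" "x \<in> ball z \<delta>" "x \<in> ball z \<sigma>" if "x \<in> S" for x
      using that \<delta>(2) by (auto simp: S_def)
    have "collinear {0, y - z, V z}"
    proof (rule exterior_ball_normal_parallel[where S = S and C = C])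
      show "open S" "z \<in> S" using \<delta>(1) \<open>\<sigma> > 0\<close> by (auto simp: S_def)
      show "((\<lambda>x. u x - v x) has_derivative (\<lambda>d. (gradient u x - gradient v x) \<bullet> d)) (at x)" if "x \<in> S" for x
        using w1 S(1)[OF that] by blast
      show "((\<lambda>x. gradient u x - gradient v x) has_derivative
        (\<lambda>d. jacobian (gradient u) (at x) *v d - jacobian (gradient v) (at x) *v d)) (at x)" if "x \<in> S" for x
        using w2 S(1)[OF that] by blast
      show "continuous_on S V" by (rule continuous_on_subset[OF contV]) (use S(1) in blast)
      show "V x \<noteq> 0" if "x \<in> S" for x
        using assms(7)[OF S(1)[OF that]] by (simp add: V_def)
      show "tangential_trace (V x) (\<lambda>d. jacobian (gradient u) (at x) *v d - jacobian (gradient v) (at x) *v d)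
          \<le> C * norm (gradient u x - gradient v x)" if "x \<in> S" for x
        using ineq[OF S(2)[OF that]] by (simp only: V_def)
      show "0 \<le> u x - v x" if "x \<in> S" for x using assms(10)[OF S(1)[OF that]] by simp
      show "u z - v z = 0" using \<open>z \<in> Z\<close> by (simp add: Z_def)
      show "0 < u x - v x" if "x \<in> S" "dist y x < dist y z" for x
        using assms(10)[OF S(1)[OF that(1)]] free[OF S(3)[OF that(1)] that(2)] S(1)[OF that(1)]
        by (simp add: Z_def)
    qed
    then show ?thesis by (simp add: insert_commute)
  qed

  \<comment> \<open>Absence of exterior balls\<close>
  have no_exterior_ball: False
    if "z \<in> Z" "y \<noteq> z" and free: "\<And>x. x \<in> U \<Longrightarrow> dist y x < dist y z \<Longrightarrow> x \<notin> Z" for y z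
  proof -
    have "z \<in> U" using \<open>z \<in> Z\<close> by (simp add: Z_def)
    define r where "r = norm (y - z)"
    have r: "r > 0" using \<open>y \<noteq> z\<close> by (simp add: r_def)
    define n where "n = (y - z) /\<^sub>R r"
    have n1: "norm n = 1" using r by (simp add: n_def r_def)
    then have nn: "n \<bullet> n = 1" by (simp add: dot_square_norm)
    have yz: "y - z = r *\<^sub>R n" using r by (simp add: n_def)
    define \<kappa> where "\<kappa> = n \<bullet> V z"
    have Vz: "V z \<noteq> 0" using assms(7)[OF \<open>z \<in> U\<close>] by (simp add: V_def)
    obtain \<sigma> where "\<sigma> > 0" "ball z \<sigma> \<subseteq> U"
      using \<open>open U\<close> \<open>z \<in> U\<close> open_contains_ball by blast
    then have "collinear {0, V z, y - z}"
      using normal[OF \<open>z \<in> Z\<close>, of \<sigma> y] free by blast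
    then have "collinear {0, y - z, V z}" by (simp only: insert_commute)
    then have "\<exists>k. V z = k *\<^sub>R (y - z)"
      using Vz \<open>y \<noteq> z\<close> by (simp add: collinear_lemma)
    then obtain k where "V z = (k * r) *\<^sub>R n" by (auto simp: yz)
    then have V\<kappa>: "V z = \<kappa> *\<^sub>R n" by (simp add: \<kappa>_def nn)
    then have \<kappa>: "\<kappa> \<noteq> 0" using Vz by auto

    have "continuous_on U (\<lambda>x. n \<bullet> V x)" by (intro continuous_on_inner continuous_on_const contV)
    then have "open ((\<lambda>x. n \<bullet> V x) -` (- {0}) \<inter> U)"
      using continuous_on_open_vimage[OF \<open>open U\<close>] by blast
    moreover have "z \<in> (\<lambda>x. n \<bullet> V x) -` (- {0}) \<inter> U" using \<kappa> \<open>z \<in> U\<close> by (simp add: \<kappa>_def)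
    ultimately obtain \<rho> where \<rho>: "\<rho> > 0" "cball z \<rho> \<subseteq> (\<lambda>x. n \<bullet> V x) -` (- {0}) \<inter> U"
      using open_contains_cball by blast
    then have inU: "x \<in> U" and nV: "n \<bullet> V x \<noteq> 0" if "dist z x \<le> \<rho>" for x using that by auto
    \<comment> \<open>Rescaling keeps the direction of V and fixes its component along
      \<open>n\<close>. The division is possible near \<open>z\<close> because V z is a nonzero
      multiple of \<open>n\<close>. For the same reason the extra term of the quotient rule in
      \<open>B\<close> points along \<open>n\<close>: on vectors orthogonal to \<open>n\<close>, the
      form of \<open>B\<close> is that of \<open>J z\<close> divided by
      \<open>\<kappa>\<close>.\<close>
    define W where "W x = V x /\<^sub>R (n \<bullet> V x)" for x
    define B where "B d = inverse \<kappa> *\<^sub>R J z d + (- (inverse \<kappa> * (n \<bullet> J z d) * inverse \<kappa>)) *\<^sub>R V z" for d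
    have dW: "(W has_derivative B) (at z)"
    proof -
      have "((\<lambda>x. n \<bullet> V x) has_derivative (\<lambda>d. n \<bullet> J z d)) (at z)"
        by (rule has_derivative_inner_right[OF dV[OF \<open>z \<in> U\<close>]])
      from has_derivative_scaleR[OF Deriv.has_derivative_inverse[OF _ this] dV[OF \<open>z \<in> U\<close>]]
      show ?thesis using \<kappa> unfolding W_def B_def \<kappa>_def by simp
    qed
    \<comment> \<open>\<open>Z\<close> is closed only relative to U; the truncated set is closed in
      the whole space, so nearest points exist.\<close>
    define K where "K = {x \<in> cball z \<rho>. u x - v x = 0}"
    have "closed K"
      unfolding K_def
      by (intro continuous_closed_preimage_constant continuous_on_subset[OF contw]) (use inU in auto)
    have KZ: "x \<in> K \<longleftrightarrow> dist z x \<le> \<rho> \<and> x \<in> Z" for x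
      using inU by (auto simp: K_def Z_def)
    \<comment> \<open>With radius rho/3, a point within rho/3 of \<open>x\<close> stays in the ball
      of radius rho, so nearest in \<open>K\<close> means locally nearest in \<open>Z\<close>. The
      constant 1/(2r) comes from expanding |y - z|^2 \<le> |y - x|^2 with y - z = r n.\<close>
    have le: "a \<bullet> B b \<le> b \<bullet> B a" if "a \<bullet> n = 0" "b \<bullet> n = 0" for a b
    proof (rule exterior_ball_derivative_form_le[where Z = K and W = W and \<rho> = "\<rho> / 3" and z = z and n = n and C = "1 / (2 * r)"])
      show "z \<in> K" using \<open>z \<in> Z\<close> \<rho>(1) by (simp add: KZ)
      show "\<rho> / 3 > 0" using \<rho>(1) by simp
      show "n \<bullet> W x = 1" if "dist z x < \<rho> / 3" for x
        using nV[of x] that \<rho>(1) by (simp add: W_def)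
      show "W z = n" using \<kappa> by (simp add: W_def \<kappa>_def[symmetric] V\<kappa> nn)
      show "\<exists>k. y' - x = k *\<^sub>R W x"
        if x: "x \<in> K" "dist z x < \<rho> / 3"
          and near: "\<And>x'. x' \<in> K \<Longrightarrow> dist y' x \<le> dist y' x'" for x y'
      proof -
        have "x' \<notin> Z" if "x' \<in> ball x (\<rho> / 3)" "dist y' x' < dist y' x" for x'
        proof
          assume "x' \<in> Z"
          moreover have "dist z x' \<le> \<rho>"
            using dist_triangle[of z x' x] x(2) that(1) \<rho>(1) by simp
          ultimately show False using near[of x'] that(2) by (simp add: KZ)
        qed
        then have "collinear {0, V x, y' - x}"
          using normal[of x "\<rho> / 3" y'] x(1) \<rho>(1) by (simp add: KZ)
        moreover have nVx: "n \<bullet> V x \<noteq> 0" using nV x(1) by (simp add: KZ)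
        then have "V x \<noteq> 0" by auto
        ultimately have "y' - x = 0 \<or> (\<exists>c. y' - x = c *\<^sub>R V x)"
          unfolding collinear_lemma by blast
        then obtain c where "y' - x = c *\<^sub>R V x"
          using scaleR_zero_left[of "V x"] by metis
        then have "y' - x = (c * (n \<bullet> V x)) *\<^sub>R W x"
          using nVx by (simp add: W_def)
        then show ?thesis ..
      qed
      show "n \<bullet> (x - z) \<le> 1 / (2 * r) * (norm (x - z))\<^sup>2" if "x \<in> K" for x
      proof -
        have "dist y z \<le> dist y x" using free[of x] inU[of x] that unfolding KZ by (meson not_le)
        then have "norm (r *\<^sub>R n) \<le> norm (r *\<^sub>R n - (x - z))"
          unfolding yz[symmetric] by (simp add: dist_norm)
        then have "(r *\<^sub>R n) \<bullet> (r *\<^sub>R n) \<le> (r *\<^sub>R n - (x - z)) \<bullet> (r *\<^sub>R n - (x - z))"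
          by (simp only: norm_le)
        also have "(c - d) \<bullet> (c - d) = c \<bullet> c - 2 * (c \<bullet> d) + d \<bullet> d" for c d :: "real^'m"
          by (simp add: inner_diff_left inner_diff_right inner_commute[of d c])
        finally have "2 * (r * (n \<bullet> (x - z))) \<le> (norm (x - z))\<^sup>2"
          by (simp only: dot_square_norm inner_scaleR_left)
        moreover have "p \<le> 1 / (2 * r) * q" if "2 * (r * p) \<le> q" for p q
          using that r by (simp add: field_simps)
        ultimately show ?thesis by blast
      qed
    qed (fact \<open>closed K\<close> n1 dW that)+
    \<comment> \<open>Using \<open>le\<close> for both orders of \<open>a\<close> and
      \<open>b\<close> makes the form of \<open>J z\<close> symmetric on the complement of
      \<open>n\<close>; subtracting the symmetric Hessian leaves the Jacobian of
      \<open>F\<close>.\<close>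
    have curl0: "a \<bullet> (curl_matrix F z *v b) = 0" if ab: "a \<bullet> n = 0" "b \<bullet> n = 0" for a b
    proof -
      have "a \<bullet> B b = b \<bullet> B a" using le ab by (simp add: antisym)
      moreover have "a \<bullet> B b = (a \<bullet> J z b) / \<kappa>" "b \<bullet> B a = (b \<bullet> J z a) / \<kappa>"
        using ab by (simp_all add: B_def V\<kappa> inner_diff_right divide_inverse mult.commute)
      ultimately have "a \<bullet> J z b = b \<bullet> J z a" using \<kappa> by simp
      moreover have "a \<bullet> (jacobian (gradient u) (at z) *v b) = b \<bullet> (jacobian (gradient u) (at z) *v a)"
        using symmetric_second_derivative[OF \<open>open U\<close> \<open>z \<in> U\<close> u1 u2[OF \<open>z \<in> U\<close>]] .
      ultimately have JF: "a \<bullet> (jacobian F (at z) *v b) = b \<bullet> (jacobian F (at z) *v a)"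
        by (simp add: J_def inner_add_right)
      have "curl_matrix F z = jacobian F (at z) - transpose (jacobian F (at z))"
        by (simp add: curl_matrix_def transpose_def vec_eq_iff)
      then have "a \<bullet> (curl_matrix F z *v b)
          = a \<bullet> (jacobian F (at z) *v b) - a \<bullet> (transpose (jacobian F (at z)) *v b)"
        by (simp add: matrix_vector_mult_diff_rdistrib inner_diff_right)
      also have "a \<bullet> (transpose (jacobian F (at z)) *v b) = b \<bullet> (jacobian F (at z) *v a)"
        unfolding transpose_matrix_vector inner_commute[of a] dot_lmul_matrix ..
      finally show ?thesis using JF by simp
    qed
    have "rank (curl_matrix F z) \<le> 2"
      by (rule rank_le_2_if_hyperplane_form_zero[OF n1]) (rule curl0)
    then show False using assms(13)[OF \<open>z \<in> U\<close>] by linarith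
  qed

  \<comment> \<open>Openness of the contact set, and connectedness\<close>
  have "open Z"
    unfolding open_contains_ball
  proof
    fix z1 assume z1: "z1 \<in> Z"
    then have "z1 \<in> U" by (simp add: Z_def)
    then obtain \<rho> where \<rho>: "\<rho> > 0" "cball z1 \<rho> \<subseteq> U"
      using \<open>open U\<close> open_contains_cball by blast
    \<comment> \<open>A point \<open>y\<close> outside \<open>Z\<close> would have a nearest contact
      point, with the ball about \<open>y\<close> as exterior ball. Halving the radius puts every
      point closer to \<open>y\<close> than that within \<open>\<rho>\<close> of \<open>z1\<close>,
      so the truncation to \<open>K\<close> loses no competitor.\<close>
    have "ball z1 (\<rho> / 2) \<subseteq> Z"
    proof (rule ccontr)
      assume "\<not> ball z1 (\<rho> / 2) \<subseteq> Z"
      then obtain y where "y \<in> ball z1 (\<rho> / 2)" and y_notin: "y \<notin> Z" by blast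
      then have y: "dist z1 y < \<rho> / 2" by simp
      define K where "K = {x \<in> cball z1 \<rho>. u x - v x = 0}"
      have "closed K"
        unfolding K_def
        by (intro continuous_closed_preimage_constant continuous_on_subset[OF contw \<rho>(2)]) auto
      moreover have "z1 \<in> K" using z1 \<rho>(1) by (simp add: K_def Z_def)
      ultimately obtain z where z: "z \<in> K" "infdist y K = dist y z"
        using infdist_attains_inf[of K y] by blast
      have near: "dist y z \<le> dist y x" if "x \<in> K" for x
        using infdist_le[OF that, of y] z(2) by simp
      have "z \<in> Z" using z(1) \<rho>(2) by (auto simp: K_def Z_def)
      moreover have "y \<noteq> z" using y_notin \<open>z \<in> Z\<close> by blast
      moreover have "x \<notin> Z" if "dist y x < dist y z" for x
      proof
        assume "x \<in> Z"
        have "dist z1 x < \<rho>"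
          using dist_triangle[of z1 x y] near[OF \<open>z1 \<in> K\<close>] that y by (simp add: dist_commute)
        then have "x \<in> K" using \<open>x \<in> Z\<close> by (simp add: K_def Z_def)
        then show False using near[of x] that by simp
      qed
      ultimately show False using no_exterior_ball by blast
    qed
    then show "\<exists>e>0. ball z1 e \<subseteq> Z" using \<rho>(1) half_gt_zero by blast
  qed
  moreover have "open (U - Z)"
  proof -
    have "U - Z = (\<lambda>x. u x - v x) -` (- {0}) \<inter> U" by (auto simp: Z_def)
    moreover have "open ((\<lambda>x. u x - v x) -` (- {0}) \<inter> U)"
      using continuous_on_open_vimage[OF \<open>open U\<close>] contw by blast
    ultimately show ?thesis by simp
  qed
  moreover have "p0 \<in> Z" using assms(11,12) by (simp add: Z_def)
  ultimately have "U - Z = {}"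
    using connectedD[OF \<open>connected U\<close>, of Z "U - Z"] \<open>p0 \<in> U\<close> by blast
  then show ?thesis by (auto simp: Z_def)
qed

end
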